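(* Let $X=\mathbb C^2$ with coordinates $(z,\xi)$, let $C=\{\xi=0\}$, let $\lambda$ be a partition of $n$ and $\lambda'$ its conjugate partition. Then, as subvarieties of the Hilbert scheme $X^{[n]}$, $$L^\lambda C=\text{Closure of }V^{\lambda'} .$$
   Context: $X^{[n]}$ is the Hilbert scheme of ideals of colength $n$ in $\mathbb C[z,\xi]$. Let $L^*C\subset\bigsqcup_nX^{[n]}$ be the closed subvariety of ideals $I$ such that $\mathbb C[z,\xi]/I$ is supported on $C$. Definition of $L^\lambda C$: consider the $\mathbb C^*$-action on $X^{[n]}$ induced by $t\cdot(z,\xi)=(z,t\xi)$. An ideal fixed by this action and supported on $C$ has the form $I=I_{D_1,z_1}\cap\cdots\cap I_{D_k,z_k}$ with distinct $z_j\in C$ and Young diagrams $D_j$, where for the partition $\mu=(\mu_1\ge\mu_2\ge\cdots)$ corresponding to $D$ (the parts $\mu_i$ being the column heights of $D$) one puts $I_{D,a}=(\xi^{\mu_1},(z-a)\xi^{\mu_2},\dots,(z-a)^{i-1}\xi^{\mu_i},\dots)$. For a partition $\lambda$ of $n$, $S^\lambda C$ is the set of such fixed $I$ for which the multiset of all columns of $D_1,\dots,D_k$ is the multiset of parts of $\lambda$; the $S^\lambda C$ are the connected components of $(X^{[n]})^{\mathbb C^*}$. One has $L^*C=\bigsqcup_n\{I\in X^{[n]}\mid\lim_{t\to\infty}t\cdot I\text{ exists}\}$; put $W^-_\lambda=\{I\in L^*C\mid\lim_{t\to\infty}t\cdot I\in S^\lambda C\}$, and let $L^\lambda C$ be the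 closure of $W_\lambda^-$. Definition of $V^{\lambda'}$: for $I\in L^*C\cap X^{[n]}$ and $i\ge1$ set $$\lambda'_i(I)=\dim\left(\frac{(\xi^{i-1})}{I\cap(\xi^{i-1})+(\xi^i)}\right),$$ where $(\xi^i)$ is the ideal generated by $\xi^i$. The sequence $\lambda'(I)=(\lambda_1'(I),\lambda_2'(I),\dots)$ is a partition of $n$. For a partition $\nu$ of $n$, $V^{\nu}=\{I\in L^*C\cap X^{[n]}\mid\lambda'(I)=\nu\}$. *)

theory Defs
  imports "HOL-Analysis.Analysis" "HOL-Computational_Algebra.Polynomial"
begin

text \<open>
  The ring \<open>\<complex>[z,\<xi>]\<close> is \<open>(\<complex>[z])[\<xi>]\<close>: the outer polynomial variable is \<open>\<xi>\<close>, the inner one is \<open>z\<close>.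
  Varieties are treated through their closed points.
\<close>

type_synonym poly2 = "complex poly poly"

definition xi :: poly2 where
  "xi = [:0, 1:]"

definition z_minus :: "complex \<Rightarrow> poly2" where
  "z_minus a = [:[:- a, 1:]:]"

definition eval2 :: "poly2 \<Rightarrow> complex \<Rightarrow> complex \<Rightarrow> complex" where
  "eval2 p a b = poly (poly p [:b:]) a"

text \<open>Ideals are the submodules of the ring, seen as a module over itself; \<open>ideal.span S\<close> is
  the ideal generated by \<open>S\<close>.\<close>

global_interpretation ideal: module "(*) :: poly2 \<Rightarrow> poly2 \<Rightarrow> poly2"
  by standard (simp_all add: algebra_simps)

text \<open>For complex subspaces \<open>B \<subseteq> A\<close>: the classes of \<open>f 0, \<dots>, f (n - 1)\<close> form a basis of the
  complex vector space \<open>A / B\<close>.  Scalar multiplication by \<open>c\<close> is \<open>smult [:c:]\<close>; coefficient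
  vectors are extensional functions on \<open>{..<n}\<close>.\<close>

definition coords_mod ::
    "poly2 set \<Rightarrow> nat \<Rightarrow> (nat \<Rightarrow> poly2) \<Rightarrow> poly2 \<Rightarrow> (nat \<Rightarrow> complex) \<Rightarrow> bool" where
  "coords_mod B n f g c \<longleftrightarrow>
     c \<in> {..<n} \<rightarrow>\<^sub>E UNIV \<and> g - (\<Sum>j<n. smult [:c j:] (f j)) \<in> B"

definition basis_mod :: "poly2 set \<Rightarrow> poly2 set \<Rightarrow> nat \<Rightarrow> (nat \<Rightarrow> poly2) \<Rightarrow> bool" where
  "basis_mod A B n f \<longleftrightarrow> (\<forall>j<n. f j \<in> A) \<and> (\<forall>g\<in>A. \<exists>!c. coords_mod B n f g c)"

definition quot_dim :: "poly2 set \<Rightarrow> poly2 set \<Rightarrow> nat" where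
  "quot_dim A B = (THE n. \<exists>f. basis_mod A B n f)"

definition hilb :: "nat \<Rightarrow> poly2 set set" where
  "hilb n = {I. ideal.subspace I \<and> (\<exists>f. basis_mod UNIV I n f)}"

text \<open>
  The Hilbert scheme is covered by the affine open charts
  \<open>U\<^sub>f = {I. f 0, \<dots>, f (n - 1) is a basis of \<complex>[z,\<xi>]/I}\<close>.  The coordinate ring of \<open>U\<^sub>f\<close> is
  generated by the functions sending \<open>I\<close> to the \<open>j\<close>-th coordinate of a polynomial \<open>g\<close> with respect
  to the basis \<open>f\<close> modulo \<open>I\<close> (the coordinates of \<open>1\<close> and of the \<open>z * f i\<close> and
  \<open>\<xi> * f i\<close> already embed \<open>U\<^sub>f\<close> as a closed subvariety of an affine space).
\<close>

definition chart :: "nat \<Rightarrow> (nat \<Rightarrow> poly2) \<Rightarrow> poly2 set set" where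
  "chart n f = {I \<in> hilb n. basis_mod UNIV I n f}"

definition chart_coord :: "nat \<Rightarrow> (nat \<Rightarrow> poly2) \<Rightarrow> poly2 \<Rightarrow> nat \<Rightarrow> poly2 set \<Rightarrow> complex" where
  "chart_coord n f g j I = (THE c. coords_mod I n f g c) j"

text \<open>Only the values on \<open>chart n f\<close> of the following functions are meaningful.\<close>

inductive_set regular_functions :: "nat \<Rightarrow> (nat \<Rightarrow> poly2) \<Rightarrow> (poly2 set \<Rightarrow> complex) set"
  for n :: nat and f :: "nat \<Rightarrow> poly2" where
  const: "(\<lambda>_. c) \<in> regular_functions n f"
| coord: "j < n \<Longrightarrow> chart_coord n f g j \<in> regular_functions n f"
| add: "h \<in> regular_functions n f \<Longrightarrow> k \<in> regular_functions n f \<Longrightarrow>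
    (\<lambda>I. h I + k I) \<in> regular_functions n f"
| mult: "h \<in> regular_functions n f \<Longrightarrow> k \<in> regular_functions n f \<Longrightarrow>
    (\<lambda>I. h I * k I) \<in> regular_functions n f"

text \<open>The Zariski topology, in which closures of subvarieties are taken, and the classical
  (Hausdorff) topology of the associated complex manifold, in which limits are taken.\<close>

definition zariski :: "nat \<Rightarrow> poly2 set topology" where
  "zariski n = topology_generated_by
     {{I \<in> chart n f. h I \<noteq> 0} | f h. h \<in> regular_functions n f}"

definition classical :: "nat \<Rightarrow> poly2 set topology" where
  "classical n = topology_generated_by
     {{I \<in> chart n f. h I \<in> W} | f h W. h \<in> regular_functions n f \<and> open W}"

lemma chart_cover: "(\<Union>f. chart n f) = hilb n"
  by (auto simp: chart_def hilb_def)

lemma topspace_zariski: "topspace (zariski n) = hilb n"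
proof -
  let ?S = "{{I \<in> chart n f. h I \<noteq> 0} | f h. h \<in> regular_functions n f}"
  have "chart n f \<in> ?S" for f
    by (rule CollectI, rule exI[of _ f], rule exI[of _ "\<lambda>_. 1"])
      (simp add: regular_functions.const)
  then have "(\<Union>f. chart n f) \<subseteq> \<Union> ?S"
    by (intro UN_least Union_upper)
  moreover have "\<Union> ?S \<subseteq> (\<Union>f. chart n f)"
    by (rule Union_least) auto
  ultimately have "\<Union> ?S = (\<Union>f. chart n f)"
    by (rule subset_antisym[rotated])
  then show ?thesis
    unfolding zariski_def topology_generated_by_topspace chart_cover .
qed

lemma topspace_classical: "topspace (classical n) = hilb n"
proof -
  let ?S = "{{I \<in> chart n f. h I \<in> W} | f h W. h \<in> regular_functions n f \<and> open W}"
  have "chart n f \<in> ?S" for f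
    by (rule CollectI, rule exI[of _ f], rule exI[of _ "\<lambda>_. 1"], rule exI[of _ UNIV])
      (simp add: regular_functions.const)
  then have "(\<Union>f. chart n f) \<subseteq> \<Union> ?S"
    by (intro UN_least Union_upper)
  moreover have "\<Union> ?S \<subseteq> (\<Union>f. chart n f)"
    by (rule Union_least) auto
  ultimately have "\<Union> ?S = (\<Union>f. chart n f)"
    by (rule subset_antisym[rotated])
  then show ?thesis
    unfolding classical_def topology_generated_by_topspace chart_cover .
qed

text \<open>Ideals of colength \<open>n\<close> supported on the line \<open>C = {\<xi> = 0}\<close>.\<close>

definition LstarC :: "nat \<Rightarrow> poly2 set set" where
  "LstarC n = {I \<in> hilb n. \<forall>a b. (\<forall>p\<in>I. eval2 p a b = 0) \<longrightarrow> b = 0}"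

text \<open>\<open>t \<cdot> I\<close> is the ideal of the image of the subscheme of \<open>I\<close> under \<open>(z, \<xi>) \<mapsto> (z, t \<xi>)\<close>: it
  consists of the polynomials \<open>p\<close> with \<open>p(z, t \<xi>) \<in> I\<close>.\<close>

definition act :: "complex \<Rightarrow> poly2 set \<Rightarrow> poly2 set" where
  "act t I = {p. pcompose p [:0, [:t:]:] \<in> I}"

text \<open>Partitions are weakly decreasing sequences of finite support, indexed from \<open>0\<close>: the part
  usually written \<open>\<lambda>\<^sub>i\<close> is \<open>l (i - 1)\<close>.\<close>

definition partition_seq :: "(nat \<Rightarrow> nat) \<Rightarrow> bool" where
  "partition_seq l \<longleftrightarrow> antimono l \<and> finite {i. l i \<noteq> 0}"

definition parts :: "(nat \<Rightarrow> nat) \<Rightarrow> nat multiset" where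
  "parts l = image_mset l (mset_set {i. l i \<noteq> 0})"

definition partition_of :: "nat \<Rightarrow> (nat \<Rightarrow> nat) \<Rightarrow> bool" where
  "partition_of n l \<longleftrightarrow> partition_seq l \<and> sum_mset (parts l) = n"

definition conjugate_partition :: "(nat \<Rightarrow> nat) \<Rightarrow> nat \<Rightarrow> nat" where
  "conjugate_partition l i = card {j. l j \<ge> i + 1}"

text \<open>\<open>I\<^bsub>D,a\<^esub>\<close> for the Young diagram \<open>D\<close> with column heights \<open>m 0 \<ge> m 1 \<ge> \<dots>\<close>.  The zero
  entries of \<open>m\<close> contribute the generator \<open>(z - a)\<^sup>l\<close>, with \<open>l\<close> the number of columns.\<close>

definition young_ideal :: "(nat \<Rightarrow> nat) \<Rightarrow> complex \<Rightarrow> poly2 set" where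
  "young_ideal m a = ideal.span (range (\<lambda>i. z_minus a ^ i * xi ^ m i))"

definition S_C :: "nat \<Rightarrow> (nat \<Rightarrow> nat) \<Rightarrow> poly2 set set" where
  "S_C n l = {I \<in> LstarC n. (\<forall>t. t \<noteq> 0 \<longrightarrow> act t I = I) \<and>
     (\<exists>(k::nat) (a :: nat \<Rightarrow> complex) (D :: nat \<Rightarrow> nat \<Rightarrow> nat).
        inj_on a {..<k} \<and> (\<forall>j<k. partition_seq (D j)) \<and>
        I = (\<Inter>j<k. young_ideal (D j) (a j)) \<and>
        (\<Sum>j<k. parts (D j)) = parts l)}"

definition W_minus :: "nat \<Rightarrow> (nat \<Rightarrow> nat) \<Rightarrow> poly2 set set" where
  "W_minus n l = {I \<in> LstarC n.
     \<exists>J \<in> S_C n l. limitin (classical n) (\<lambda>t. act t I) J at_infinity}"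

definition L_C :: "nat \<Rightarrow> (nat \<Rightarrow> nat) \<Rightarrow> poly2 set set" where
  "L_C n l = zariski n closure_of W_minus n l"

text \<open>\<open>lambda' I i\<close> is the dimension of \<open>(\<xi>\<^sup>i) / (I \<inter> (\<xi>\<^sup>i) + (\<xi>\<^bsup>i+1\<^esup>))\<close>, that is, the
  number usually written \<open>\<lambda>'\<close> with index \<open>i + 1\<close>.\<close>

definition lambda' :: "poly2 set \<Rightarrow> nat \<Rightarrow> nat" where
  "lambda' I i = quot_dim (ideal.span {xi ^ i})
     {p + q | p q. p \<in> I \<inter> ideal.span {xi ^ i} \<and> q \<in> ideal.span {xi ^ (i + 1)}}"

definition V :: "nat \<Rightarrow> (nat \<Rightarrow> nat) \<Rightarrow> poly2 set set" where
  "V n nu = {I \<in> LstarC n. lambda' I = nu}"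

end

theory Submission
  imports "Jordan_Normal_Form.Determinant" Defs "HOL-Computational_Algebra.Fundamental_Theorem_Algebra"
begin

text \<open>
  In fact \<open>W\<^sup>-\<^sub>\<lambda> = V\<^bsup>\<lambda>'\<^esup>\<close> before taking closures.  For \<open>I\<close> supported on \<open>C\<close>, the coefficients of \<open>\<xi>\<^sup>i\<close>
  in elements of \<open>I\<close> of \<open>\<xi>\<close>-order at least \<open>i\<close> form a nonzero ideal \<open>(g\<^sub>i)\<close> of \<open>\<complex>[z]\<close>, with
  \<open>deg g\<^sub>i = \<lambda>'\<^bsub>i+1\<^esub>(I)\<close>.  As \<open>t \<rightarrow> \<infinity>\<close> the ideals \<open>t \<cdot> I\<close> converge to the initial ideal
  \<open>J = \<Oplus> (g\<^sub>i) \<xi>\<^sup>i\<close>: the monomials \<open>z\<^sup>k \<xi>\<^sup>i\<close> with \<open>k < deg g\<^sub>i\<close> form a basis modulo every \<open>t \<cdot> I\<close> and modulo \<open>J\<close>,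
  and the coordinates modulo \<open>t \<cdot> I\<close> are polynomials in \<open>1/t\<close> whose constant terms are the coordinates
  modulo \<open>J\<close>.  Factoring the \<open>g\<^sub>i\<close> into linear factors writes \<open>J\<close> as an intersection of ideals \<open>I\<^bsub>D,a\<^esub>\<close>,
  where the total number of columns of height greater than \<open>i\<close> is \<open>deg g\<^sub>i\<close>; so \<open>J\<close> lies in \<open>S\<^sup>\<lambda>C\<close>
  if and only if \<open>\<lambda>'(I)\<close> is the conjugate of \<open>\<lambda>\<close>.
\<close>

section \<open>Bases modulo an ideal\<close>

abbreviation lincomb :: "nat \<Rightarrow> (nat \<Rightarrow> poly2) \<Rightarrow> (nat \<Rightarrow> complex) \<Rightarrow> poly2" where
  "lincomb n f c \<equiv> \<Sum>j<n. smult [:c j:] (f j)"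

lemma subspace_smult:
  assumes "ideal.subspace I" "p \<in> I"
  shows "smult a p \<in> I"
proof -
  have "[:a:] * p \<in> I" by (rule ideal.subspace_scale[OF assms])
  then show ?thesis by simp
qed

lemma smult_sum_right: "smult a (sum f S) = (\<Sum>i\<in>S. smult a (f i))"
  by (induction S rule: infinite_finite_induct) (simp_all add: smult_add_right)

text \<open>The description in \<open>chart_coord\<close> mentions only \<open>B\<close>, so it
  gives coordinates in every quotient \<open>A / B\<close>, not only in charts of the Hilbert
  scheme.\<close>

lemma basis_mod_coord:
  assumes "basis_mod A B n f" "g \<in> A"
  shows "g - lincomb n f (\<lambda>j. chart_coord n f g j B) \<in> B"
proof -
  have "\<exists>!c. coords_mod B n f g c"
    using assms by (simp add: basis_mod_def)
  then have "coords_mod B n f g (THE c. coords_mod B n f g c)"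
    by (rule theI')
  then show ?thesis
    by (simp add: coords_mod_def chart_coord_def)
qed

lemma basis_mod_coord_unique:
  assumes "basis_mod A B n f" "g \<in> A" "g - lincomb n f c \<in> B" "j < n"
  shows "chart_coord n f g j B = c j"
proof -
  have ex1: "\<exists>!c. coords_mod B n f g c"
    using assms by (simp add: basis_mod_def)
  \<comment> \<open>Coordinate vectors are extensional by definition, so an arbitrary
    \<open>c\<close> is first cut down to \<open>{..<n}\<close>.\<close>
  have "lincomb n f (restrict c {..<n}) = lincomb n f c"
    by (rule sum.cong) auto
  then have "coords_mod B n f g (restrict c {..<n})"
    using assms(3) by (simp add: coords_mod_def)
  then have "(THE c. coords_mod B n f g c) = restrict c {..<n}"
    using ex1 by (rule the1_equality[rotated])
  then show ?thesis
    using assms(4) by (simp add: chart_coord_def)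
qed

lemma basis_modI:
  assumes "\<And>j. j < n \<Longrightarrow> f j \<in> A"
    and ex: "\<And>g. g \<in> A \<Longrightarrow> g - lincomb n f (C g) \<in> B"
    and uniq: "\<And>g c j. g \<in> A \<Longrightarrow> g - lincomb n f c \<in> B \<Longrightarrow> j < n \<Longrightarrow> c j = C g j"
  shows "basis_mod A B n f"
  unfolding basis_mod_def
proof (intro conjI allI impI ballI)
  fix g assume g: "g \<in> A"
  have "lincomb n f (restrict (C g) {..<n}) = lincomb n f (C g)"
    by (rule sum.cong) auto
  then have 1: "coords_mod B n f g (restrict (C g) {..<n})"
    using ex[OF g] by (simp add: coords_mod_def)
  show "\<exists>!c. coords_mod B n f g c"
  proof (rule ex1I[where P="coords_mod B n f g", OF 1])
    fix c assume c: "coords_mod B n f g c"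
    show "c = restrict (C g) {..<n}"
    proof
      fix j show "c j = restrict (C g) {..<n} j"
        using c uniq[OF g, of c j] by (cases "j < n") (auto simp: coords_mod_def PiE_def extensional_def)
    qed
  qed
qed (use assms in auto)

lemma coord_zero_iff:
  assumes "basis_mod A B n f" "g \<in> A" "ideal.subspace B"
  shows "g \<in> B \<longleftrightarrow> (\<forall>j<n. chart_coord n f g j B = 0)"
proof
  assume "g \<in> B"
  then have "g - lincomb n f (\<lambda>_. 0) \<in> B" by simp
  then show "\<forall>j<n. chart_coord n f g j B = 0"
    using basis_mod_coord_unique[OF assms(1,2), of "\<lambda>_. 0"] by simp
next
  assume "\<forall>j<n. chart_coord n f g j B = 0"
  then have "lincomb n f (\<lambda>j. chart_coord n f g j B) = 0"
    by (intro sum.neutral) auto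
  then show "g \<in> B"
    using basis_mod_coord[OF assms(1,2)] by simp
qed

text \<open>Substitute the expansions of the \<open>f i\<close> into that of \<open>g\<close>. This
  also covers families that are dependent modulo \<open>B\<close>.\<close>

lemma coord_trans:
  assumes B: "ideal.subspace B"
    and g: "g - lincomb n f c \<in> B"
    and f: "\<And>i. i < n \<Longrightarrow> f i - lincomb m f' (Q i) \<in> B"
  shows "g - lincomb m f' (\<lambda>k. \<Sum>i<n. c i * Q i k) \<in> B"
proof -
  have "(\<Sum>i<n. smult [:c i:] (f i - lincomb m f' (Q i))) \<in> B"
    using f by (intro ideal.subspace_sum subspace_smult B) auto
  then have "g - lincomb n f c + (\<Sum>i<n. smult [:c i:] (f i - lincomb m f' (Q i))) \<in> B"
    by (rule ideal.subspace_add[OF B g])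
  also have "g - lincomb n f c + (\<Sum>i<n. smult [:c i:] (f i - lincomb m f' (Q i)))
      = g - (\<Sum>i<n. smult [:c i:] (lincomb m f' (Q i)))"
    by (simp add: smult_diff_right sum_subtractf)
  also have "(\<Sum>i<n. smult [:c i:] (lincomb m f' (Q i))) = (\<Sum>i<n. \<Sum>k<m. smult [:c i * Q i k:] (f' k))"
    by (simp add: smult_sum_right mult.commute)
  also have "\<dots> = (\<Sum>k<m. \<Sum>i<n. smult [:c i * Q i k:] (f' k))"
    by (rule sum.swap)
  also have "\<dots> = lincomb m f' (\<lambda>k. \<Sum>i<n. c i * Q i k)"
  proof (rule sum.cong[OF refl])
    fix k
    have "[:\<Sum>i<n. c i * Q i k:] = (\<Sum>i<n. [:c i * Q i k:])"
      by (induction n) (simp_all, metis add_pCons add.right_neutral)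
    then show "(\<Sum>i<n. smult [:c i * Q i k:] (f' k)) = smult [:\<Sum>i<n. c i * Q i k:] (f' k)"
      by (simp add: smult_sum)
  qed
  finally show ?thesis .
qed

lemma coord_change:
  assumes "ideal.subspace B" "basis_mod A B n f" "basis_mod A B m f'" "g \<in> A" "k < m"
  shows "chart_coord m f' g k B = (\<Sum>i<n. chart_coord n f g i B * chart_coord m f' (f i) k B)"
proof -
  have "g - lincomb m f' (\<lambda>k. \<Sum>i<n. chart_coord n f g i B * chart_coord m f' (f i) k B) \<in> B"
    using assms(2) by (intro coord_trans[OF assms(1) basis_mod_coord[OF assms(2,4)] basis_mod_coord[OF assms(3)]])
      (auto simp: basis_mod_def)
  from basis_mod_coord_unique[OF assms(3,4) this assms(5)] show ?thesis .
qed

lemma coord_self: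
  assumes "ideal.subspace B" "basis_mod A B n f" "i < n" "j < n"
  shows "chart_coord n f (f i) j B = (if j = i then 1 else 0)"
proof -
  have "lincomb n f (\<lambda>j. if j = i then 1 else 0) = (\<Sum>j<n. if j = i then f j else 0)"
    by (intro sum.cong) (auto simp: one_pCons[symmetric])
  also have "\<dots> = f i" using assms by simp
  finally have "f i - lincomb n f (\<lambda>j. if j = i then 1 else 0) \<in> B"
    using ideal.subspace_0[OF assms(1)] by simp
  from basis_mod_coord_unique[OF assms(2) _ this assms(4)] show ?thesis
    using assms by (simp add: basis_mod_def)
qed

text \<open>The two transition matrices between bases are mutually inverse, and their products in the
  two orders have the same trace.\<close>

lemma basis_mod_size_unique:
  assumes B: "ideal.subspace B" and f: "basis_mod A B n f" and f': "basis_mod A B m f'"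
  shows "n = m"
proof -
  have trace: "of_nat m = (\<Sum>k<m. \<Sum>i<n. chart_coord n f (f' k) i B * chart_coord m f' (f i) k B)"
    if f: "basis_mod A B n f" and f': "basis_mod A B m f'" for n m f f'
  proof -
    have "(\<Sum>i<n. chart_coord n f (f' k) i B * chart_coord m f' (f i) k B) = 1" if "k < m" for k
      using coord_change[OF B f f', of "f' k" k] coord_self[OF B f' that that] that f'
      by (simp add: basis_mod_def)
    then show ?thesis by simp
  qed
  \<comment> \<open>Both sizes are traces of identity matrices; they are compared in the complex
    numbers, where \<open>of_nat\<close> is injective.\<close>
  have "(of_nat m :: complex) = (\<Sum>k<m. \<Sum>i<n. chart_coord n f (f' k) i B * chart_coord m f' (f i) k B)"
    by (rule trace[OF f f'])
  also have "\<dots> = (\<Sum>i<n. \<Sum>k<m. chart_coord m f' (f i) k B * chart_coord n f (f' k) i B)"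
    by (subst sum.swap) (simp add: mult.commute)
  also have "\<dots> = of_nat n"
    by (rule trace[OF f' f, symmetric])
  finally show ?thesis by simp
qed

lemma quot_dim_eq:
  assumes "ideal.subspace B" "basis_mod A B n f"
  shows "quot_dim A B = n"
  unfolding quot_dim_def
  using assms basis_mod_size_unique by (intro the_equality) blast+

text \<open>Padding the coordinate matrix of the \<open>n + 1\<close> vectors by a zero row makes it
  square and singular; a kernel vector is the desired relation. The vectors will be powers of
  \<open>z\<close> or of \<xi>.\<close>

lemma mod_dependent:
  assumes I: "ideal.subspace I" and f: "basis_mod UNIV I n f"
  obtains c where "\<exists>k\<le>n. c k \<noteq> 0" "(\<Sum>k\<le>n. smult [:c k:] (v k)) \<in> I"
proof -
  define M where "M = Matrix.mat (Suc n) (Suc n) (\<lambda>(j, k). if j < n then chart_coord n f (v k) j I else 0)"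
  have M: "M \<in> carrier_mat (Suc n) (Suc n)" by (simp add: M_def)
  \<comment> \<open>The padding row is a zero column of the transpose, which therefore kills a unit
    vector.\<close>
  have "transpose_mat M *\<^sub>v unit_vec (Suc n) n = 0\<^sub>v (Suc n)"
    by (intro eq_vecI) (auto simp: M_def)
  moreover have "unit_vec (Suc n) n \<noteq> (0\<^sub>v (Suc n) :: complex Matrix.vec)" by simp
  ultimately have "Determinant.det (transpose_mat M) = 0"
    using M by (subst det_0_iff_vec_prod_zero[of _ "Suc n"]) (auto intro!: exI[of _ "unit_vec (Suc n) n"])
  then have "Determinant.det M = 0" using Determinant.det_transpose[OF M] by simp
  then obtain w where w: "w \<in> carrier_vec (Suc n)" "w \<noteq> 0\<^sub>v (Suc n)" "M *\<^sub>v w = 0\<^sub>v (Suc n)"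
    using M by (auto simp: det_0_iff_vec_prod_zero)
  define c where "c k = vec_index w k" for k
  have "\<exists>k\<le>n. c k \<noteq> 0"
  proof (rule ccontr)
    assume "\<not> ?thesis"
    then have "w = 0\<^sub>v (Suc n)" using w(1) by (intro eq_vecI) (auto simp: c_def)
    with w(2) show False by simp
  qed
  moreover have "(\<Sum>k\<le>n. smult [:c k:] (v k)) \<in> I"
  proof -
    have "(\<Sum>k<Suc n. c k * chart_coord n f (v k) j I) = 0" if "j < n" for j
    proof -
      have "vec_index (M *\<^sub>v w) j = 0" using w(3) that by simp
      moreover have "vec_index (M *\<^sub>v w) j = (\<Sum>k<Suc n. c k * chart_coord n f (v k) j I)"
        using that w(1) by (simp add: M_def scalar_prod_def c_def mult.commute lessThan_atLeast0)
      ultimately show ?thesis by simp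
    qed
    then have "lincomb n f (\<lambda>j. \<Sum>k<Suc n. c k * chart_coord n f (v k) j I) = 0"
      by (intro sum.neutral) auto
    moreover have "lincomb (Suc n) v c - lincomb n f (\<lambda>j. \<Sum>k<Suc n. c k * chart_coord n f (v k) j I) \<in> I"
      using ideal.subspace_0[OF I] by (intro coord_trans[OF I _ basis_mod_coord[OF f]]) auto
    ultimately show ?thesis by (simp add: lessThan_Suc_atMost)
  qed
  ultimately show ?thesis using that by blast
qed

section \<open>Changing charts, and limits in the classical topology\<close>

text \<open>By the Leibniz formula the determinant is a polynomial in the entries.\<close>

lemma tendsto_mat_det:
  fixes M :: "'a \<Rightarrow> complex Matrix.mat"
  assumes "\<And>t. M t \<in> carrier_mat n n" "L \<in> carrier_mat n n"
    and "\<And>i j. i < n \<Longrightarrow> j < n \<Longrightarrow> ((\<lambda>t. M t $$ (i, j)) \<longlongrightarrow> L $$ (i, j)) F"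
  shows "((\<lambda>t. Determinant.det (M t)) \<longlongrightarrow> Determinant.det L) F"
  unfolding det_def'[OF assms(1)] det_def'[OF assms(2)]
proof (intro tendsto_sum tendsto_mult tendsto_const tendsto_prod assms(3))
  fix p i assume "p \<in> {p. p permutes {0..<n}}" "i \<in> {0..<n}"
  then show "i < n" "p i < n" by (auto dest: permutes_in_image)
qed

section \<open>Transition matrices and Cramer's rule\<close>

definition transition :: "nat \<Rightarrow> (nat \<Rightarrow> poly2) \<Rightarrow> (nat \<Rightarrow> poly2) \<Rightarrow> poly2 set \<Rightarrow> complex Matrix.mat" where
  "transition n b f B = Matrix.mat n n (\<lambda>(s, j). chart_coord n b (f j) s B)"

definition coord_vec :: "nat \<Rightarrow> (nat \<Rightarrow> poly2) \<Rightarrow> poly2 \<Rightarrow> poly2 set \<Rightarrow> complex Matrix.vec" where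
  "coord_vec n b p B = Matrix.vec n (\<lambda>s. chart_coord n b p s B)"

lemma transition_carrier [simp]: "transition n b f B \<in> carrier_mat n n"
  by (simp add: transition_def)

lemma coord_vec_carrier [simp]: "coord_vec n b p B \<in> carrier_vec n"
  by (simp add: coord_vec_def)

text \<open>The change of basis formula makes \<open>transition n f b B\<close> an inverse.\<close>

lemma det_transition_nonzero:
  assumes B: "ideal.subspace B" and b: "basis_mod UNIV B n b" and f: "basis_mod UNIV B n f"
  shows "Determinant.det (transition n b f B) \<noteq> 0"
proof -
  have "transition n b f B * transition n f b B = 1\<^sub>m n"
  proof (rule eq_matI)
    fix s k assume "s < dim_row (1\<^sub>m n)" "k < dim_col (1\<^sub>m n)"
    then have sk: "s < n" "k < n" by auto
    show "(transition n b f B * transition n f b B) $$ (s, k) = 1\<^sub>m n $$ (s, k)"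
      using coord_change[OF B f b, of "b k" s] coord_self[OF B b sk(2,1)] sk
      by (simp add: transition_def scalar_prod_def lessThan_atLeast0 mult.commute)
  qed (auto simp: transition_def)
  then have "Determinant.det (transition n b f B) * Determinant.det (transition n f b B) = 1"
    by (metis det_mult det_one transition_carrier)
  then show ?thesis by auto
qed

text \<open>Expanding \<open>p\<close> in an arbitrary family \<open>f\<close> modulo
  \<open>B\<close> becomes a square linear system, written in the reference basis
  \<open>b\<close>.\<close>

lemma transition_mult_vec_iff:
  assumes B: "ideal.subspace B" and b: "basis_mod UNIV B n b"
  shows "p - lincomb n f c \<in> B \<longleftrightarrow> transition n b f B *\<^sub>v Matrix.vec n c = coord_vec n b p B"
proof -
  define d where "d s = (\<Sum>j<n. c j * chart_coord n b (f j) s B)" for s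
  have d: "transition n b f B *\<^sub>v Matrix.vec n c = coord_vec n b p B \<longleftrightarrow>
    (\<forall>s<n. d s = chart_coord n b p s B)"
  proof -
    have "vec_index (transition n b f B *\<^sub>v Matrix.vec n c) s = d s" if "s < n" for s
      using that by (simp add: transition_def scalar_prod_def d_def lessThan_atLeast0 mult.commute)
    then show ?thesis
      by (auto simp: Matrix.vec_eq_iff coord_vec_def transition_def)
  qed
  have lin: "lincomb n f c - lincomb n b d \<in> B"
    unfolding d_def using ideal.subspace_0[OF B]
    by (intro coord_trans[OF B _ basis_mod_coord[OF b]]) auto
  show ?thesis unfolding d
  proof
    assume "p - lincomb n f c \<in> B"
    then have "p - lincomb n b d \<in> B"
      using ideal.subspace_add[OF B _ lin] by force
    then show "\<forall>s<n. d s = chart_coord n b p s B"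
      using basis_mod_coord_unique[OF b] by auto
  next
    assume "\<forall>s<n. d s = chart_coord n b p s B"
    then have "lincomb n b d = lincomb n b (\<lambda>s. chart_coord n b p s B)"
      by (intro sum.cong) auto
    then have "p - lincomb n b d \<in> B"
      using basis_mod_coord[OF b, of p] by simp
    then show "p - lincomb n f c \<in> B"
      using ideal.subspace_diff[OF B _ lin] by force
  qed
qed

text \<open>An invertible transition matrix makes the system uniquely solvable, so \<open>f\<close>
  is a basis. Cramer's rule writes its coordinates as quotients of determinants in
  \<open>b\<close>-coordinates, which is what makes changes of chart continuous.\<close>

lemma cramer_coords:
  assumes B: "ideal.subspace B" and b: "basis_mod UNIV B n b"
    and det: "Determinant.det (transition n b f B) \<noteq> 0"
  shows "basis_mod UNIV B n f"
    and "j < n \<Longrightarrow> chart_coord n f p j B =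
      Determinant.det (replace_col (transition n b f B) (coord_vec n b p B) j)
        / Determinant.det (transition n b f B)"
proof -
  let ?T = "transition n b f B"
  define C where "C p j = Determinant.det (replace_col ?T (coord_vec n b p B) j) / Determinant.det ?T" for p j
  have uniq: "c j = C p j" if "p - lincomb n f c \<in> B" "j < n" for p c j
  proof -
    have "?T *\<^sub>v Matrix.vec n c = coord_vec n b p B"
      using that(1) transition_mult_vec_iff[OF B b] by blast
    moreover have "Determinant.det (replace_col ?T (?T *\<^sub>v Matrix.vec n c) j) =
        vec_index (Matrix.vec n c) j * Determinant.det ?T"
      by (rule cramer_lemma_mat) (use that in auto)
    ultimately show ?thesis
      using det that(2) by (simp add: C_def field_simps)
  qed
  have ex: "\<exists>c. p - lincomb n f c \<in> B" for p
  proof -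
    define w where "w = coord_vec n b p B"
    \<comment> \<open>The adjugate divided by the determinant is the inverse matrix and produces the
      solution.\<close>
    define x where "x = (1 / Determinant.det ?T) \<cdot>\<^sub>v (adj_mat ?T *\<^sub>v w)"
    have adj: "adj_mat ?T \<in> carrier_mat n n" "?T * adj_mat ?T = Determinant.det ?T \<cdot>\<^sub>m 1\<^sub>m n"
      using adj_mat[of ?T n] by auto
    have w: "w \<in> carrier_vec n" by (simp add: w_def)
    have x: "x \<in> carrier_vec n" using adj w by (simp add: x_def)
    have "?T *\<^sub>v x = (1 / Determinant.det ?T) \<cdot>\<^sub>v (?T *\<^sub>v (adj_mat ?T *\<^sub>v w))"
      unfolding x_def by (rule mult_mat_vec[of _ n n]) (use adj w in auto)
    also have "?T *\<^sub>v (adj_mat ?T *\<^sub>v w) = (?T * adj_mat ?T) *\<^sub>v w"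
      by (rule assoc_mult_mat_vec[symmetric, of _ n n _ n]) (use adj w in auto)
    also have "\<dots> = Determinant.det ?T \<cdot>\<^sub>v w"
      unfolding adj(2) using w by (intro eq_vecI) (auto simp: scalar_prod_left_unit)
    also have "(1 / Determinant.det ?T) \<cdot>\<^sub>v \<dots> = w"
      using det by (simp add: smult_smult_assoc)
    finally have "?T *\<^sub>v x = w" .
    moreover have "x = Matrix.vec n (vec_index x)" using x by (intro eq_vecI) auto
    ultimately have "p - lincomb n f (vec_index x) \<in> B"
      using transition_mult_vec_iff[OF B b] by (simp add: w_def)
    then show ?thesis by blast
  qed
  show f: "basis_mod UNIV B n f"
  proof (rule basis_modI[where C = C])
    fix p
    obtain c where c: "p - lincomb n f c \<in> B" using ex by blast
    moreover have "lincomb n f c = lincomb n f (C p)"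
      using uniq[OF c] by (intro sum.cong) auto
    ultimately show "p - lincomb n f (C p) \<in> B" by simp
  qed (use uniq in auto)
  show "chart_coord n f p j B = Determinant.det (replace_col ?T (coord_vec n b p B) j) / Determinant.det ?T"
    if "j < n"
    using uniq[OF basis_mod_coord[OF f] that, of p] by (simp add: C_def)
qed

lemma subspace_hilb: "B \<in> hilb n \<Longrightarrow> ideal.subspace B"
  by (simp add: hilb_def)

lemma chartD:
  assumes "B \<in> chart n f"
  shows "ideal.subspace B" "basis_mod UNIV B n f"
  using assms by (auto simp: chart_def hilb_def)

lemma chartI:
  assumes "ideal.subspace B" "basis_mod UNIV B n f"
  shows "B \<in> chart n f"
  using assms by (auto simp: chart_def hilb_def)

section \<open>Convergence tested in one chart\<close>

context
  fixes n :: nat and b :: "nat \<Rightarrow> poly2" and X :: "'a \<Rightarrow> poly2 set" and F :: "'a filter"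
    and J :: "poly2 set"
  assumes ev: "\<forall>\<^sub>F t in F. X t \<in> chart n b"
    and J: "J \<in> chart n b"
    and lim: "\<And>p s. s < n \<Longrightarrow>
      ((\<lambda>t. chart_coord n b p s (X t)) \<longlongrightarrow> chart_coord n b p s J) F"
begin

lemma tendsto_transition:
  "((\<lambda>t. Determinant.det (transition n b f (X t))) \<longlongrightarrow> Determinant.det (transition n b f J)) F"
  by (rule tendsto_mat_det[of _ n]) (auto simp: transition_def lim)

lemma eventually_transition:
  assumes "J \<in> chart n f"
  shows "\<forall>\<^sub>F t in F. Determinant.det (transition n b f (X t)) \<noteq> 0"
  using tendsto_transition
  by (rule tendsto_imp_eventually_ne) (use det_transition_nonzero assms J chartD in blast)

text \<open>Inside the chart of \<open>b\<close>, being a basis is the nonvanishing of a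
  determinant, an open condition.\<close>

lemma eventually_chart:
  assumes "J \<in> chart n f"
  shows "\<forall>\<^sub>F t in F. X t \<in> chart n f"
  using ev eventually_transition[OF assms]
  by eventually_elim (use cramer_coords(1) chartD chartI in blast)

lemma tendsto_chart_coord:
  assumes f: "J \<in> chart n f" and j: "j < n"
  shows "((\<lambda>t. chart_coord n f p j (X t)) \<longlongrightarrow> chart_coord n f p j J) F"
proof -
  let ?D = "\<lambda>B. Determinant.det (replace_col (transition n b f B) (coord_vec n b p B) j)
      / Determinant.det (transition n b f B)"
  have nz: "Determinant.det (transition n b f J) \<noteq> 0"
    using det_transition_nonzero f J chartD by blast
  have "((\<lambda>t. ?D (X t)) \<longlongrightarrow> ?D J) F"
    by (intro tendsto_divide tendsto_transition nz tendsto_mat_det[of _ n])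
      (auto simp: replace_col_def transition_def coord_vec_def lim)
  moreover have "\<forall>\<^sub>F t in F. ?D (X t) = chart_coord n f p j (X t)"
    using ev eventually_transition[OF f]
    by eventually_elim (rule cramer_coords(2)[OF _ _ _ j, symmetric], auto dest: chartD)
  moreover have "?D J = chart_coord n f p j J"
    using cramer_coords(2)[OF _ _ nz j, of p] J chartD by auto
  ultimately show ?thesis
    using tendsto_cong by force
qed

lemma tendsto_regular_function:
  assumes f: "J \<in> chart n f" and h: "h \<in> regular_functions n f"
  shows "((\<lambda>t. h (X t)) \<longlongrightarrow> h J) F"
  using h by induction (auto intro: tendsto_intros tendsto_chart_coord[OF f])

text \<open>The topology is generated by sets from all charts. Since changes of chart are continuous
  near \<open>J\<close>, convergence of the \<open>b\<close>-coordinates handles every generator;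
  induction over the generated topology does the rest.\<close>

lemma limitin_classicalI: "limitin (classical n) X J F"
  unfolding limitin_def
proof (intro conjI allI impI)
  show "J \<in> topspace (classical n)"
    using J by (simp add: topspace_classical chart_def)
next
  fix U assume "openin (classical n) U \<and> J \<in> U"
  then have U: "J \<in> U" and "generate_topology_on
      {{I \<in> chart n f. h I \<in> W} | f h W. h \<in> regular_functions n f \<and> open W} U"
    by (auto simp: classical_def openin_topology_generated_by_iff)
  from this(2,1) show "\<forall>\<^sub>F t in F. X t \<in> U"
  proof induction
    case (Basis s)
    then obtain f h W where s: "s = {I \<in> chart n f. h I \<in> W}"
      "h \<in> regular_functions n f" "open W" by blast
    with Basis have f: "J \<in> chart n f" and "h J \<in> W" by auto
    then have "\<forall>\<^sub>F t in F. h (X t) \<in> W"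
      using tendsto_regular_function s topological_tendstoD by blast
    with eventually_chart[OF f] show ?case
      by eventually_elim (simp add: s)
  next
    case (UN K)
    then obtain k where "k \<in> K" "J \<in> k" by blast
    with UN have "\<forall>\<^sub>F t in F. X t \<in> k" by blast
    then show ?case by eventually_elim (use \<open>k \<in> K\<close> in blast)
  qed (auto intro: eventually_conj)
qed

end

text \<open>Basic open sets with constant \<open>h\<close> and \<open>W = UNIV\<close> give the
  chart itself; those with a coordinate function give convergence of that coordinate.\<close>

lemma limitin_classicalD:
  assumes lim: "limitin (classical n) X J F" and J: "J \<in> chart n f"
  shows "\<forall>\<^sub>F t in F. X t \<in> chart n f"
    and "j < n \<Longrightarrow> ((\<lambda>t. chart_coord n f p j (X t)) \<longlongrightarrow> chart_coord n f p j J) F"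
proof -
  have open_basic: "openin (classical n) {I \<in> chart n f. h I \<in> W}"
    if "h \<in> regular_functions n f" "open W" for h W
    unfolding classical_def by (rule topology_generated_by_Basis) (use that in blast)
  have *: "\<forall>\<^sub>F t in F. X t \<in> chart n f \<and> h (X t) \<in> W"
    if "h \<in> regular_functions n f" "open W" "h J \<in> W" for h W
    using open_basic[OF that(1,2)] lim that(3) J by (auto simp: limitin_def)
  show "\<forall>\<^sub>F t in F. X t \<in> chart n f"
    using *[OF regular_functions.const[of 0], of UNIV] by simp
  show "((\<lambda>t. chart_coord n f p j (X t)) \<longlongrightarrow> chart_coord n f p j J) F" if "j < n"
  proof (rule topological_tendstoI)
    fix S assume "open S" "chart_coord n f p j J \<in> S"
    from *[OF regular_functions.coord[OF that] this]
    show "\<forall>\<^sub>F t in F. chart_coord n f p j (X t) \<in> S"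
      by eventually_elim simp
  qed
qed

text \<open>One half of the Hausdorff property. For \<open>p \<in> J'\<close>, its coordinates in a
  chart around \<open>J\<close> are sums of products of coordinates in a chart around
  \<open>J'\<close>, which tend to zero, with convergent factors.\<close>

lemma limitin_classical_subset:
  assumes J: "limitin (classical n) X J F" and J': "limitin (classical n) X J' F"
    and F: "F \<noteq> bot"
  shows "J' \<subseteq> J"
proof
  obtain f f' where f: "J \<in> chart n f" and f': "J' \<in> chart n f'"
    using J J' by (auto simp: limitin_def topspace_classical chart_cover[symmetric])
  fix p assume p: "p \<in> J'"
  have "chart_coord n f p j J = 0" if j: "j < n" for j
  proof -
    have zero: "chart_coord n f' p i J' = 0" if "i < n" for i
      using coord_zero_iff[OF chartD(2)[OF f'], of p] chartD(1)[OF f'] p that by auto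
    have "((\<lambda>t. \<Sum>i<n. chart_coord n f' p i (X t) * chart_coord n f (f' i) j (X t))
        \<longlongrightarrow> (\<Sum>i<n. chart_coord n f' p i J' * chart_coord n f (f' i) j J)) F"
      using j by (intro tendsto_sum tendsto_mult limitin_classicalD(2)[OF J f] limitin_classicalD(2)[OF J' f']) auto
    then have "((\<lambda>t. \<Sum>i<n. chart_coord n f' p i (X t) * chart_coord n f (f' i) j (X t)) \<longlongrightarrow> 0) F"
      by (simp add: zero)
    moreover have "\<forall>\<^sub>F t in F. (\<Sum>i<n. chart_coord n f' p i (X t) * chart_coord n f (f' i) j (X t))
        = chart_coord n f p j (X t)"
      using limitin_classicalD(1)[OF J f] limitin_classicalD(1)[OF J' f']
      by eventually_elim (rule coord_change[where A = UNIV, symmetric], use chartD j in auto)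
    ultimately have "((\<lambda>t. chart_coord n f p j (X t)) \<longlongrightarrow> 0) F"
      using tendsto_cong by force
    with limitin_classicalD(2)[OF J f j] show ?thesis
      using F tendsto_unique by blast
  qed
  then show "p \<in> J"
    using coord_zero_iff[OF chartD(2)[OF f], of p] chartD(1)[OF f] by auto
qed

lemma limitin_classical_unique:
  assumes "limitin (classical n) X J F" "limitin (classical n) X J' F" "F \<noteq> bot"
  shows "J = J'"
  using limitin_classical_subset assms by blast

section \<open>Normal forms modulo an ideal\<close>

lemma xi_power: "xi ^ i = monom 1 i"
  by (simp add: xi_def monom_altdef)

lemma span_xi: "ideal.span {xi ^ i} = {p. \<forall>m<i. coeff p m = 0}"
proof -
  have "ideal.span {xi ^ i} = {p. xi ^ i dvd p}"
    by (auto simp: ideal.span_singleton dvd_def mult.commute)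
  then show ?thesis by (simp add: xi_power monom_1_dvd_iff')
qed

text \<open>For nonzero \<open>g i\<close> each coefficient is zero or of degree below that of
  \<open>g i\<close>; the form with \<open>mod\<close> treats both cases at once.\<close>

definition reduced :: "(nat \<Rightarrow> complex poly) \<Rightarrow> poly2 \<Rightarrow> bool" where
  "reduced g R \<longleftrightarrow> (\<forall>i. coeff R i mod g i = coeff R i)"

lemma reduced_0 [simp]: "reduced g 0"
  by (simp add: reduced_def)

lemma reduced_add: "reduced g R \<Longrightarrow> reduced g S \<Longrightarrow> reduced g (R + S)"
  by (simp add: reduced_def poly_mod_add_left)

lemma reduced_diff: "reduced g R \<Longrightarrow> reduced g S \<Longrightarrow> reduced g (R - S)"
  by (simp add: reduced_def poly_mod_diff_left)

lemma reduced_smult: "reduced g R \<Longrightarrow> reduced g (smult [:c:] R)"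
  by (simp add: reduced_def mod_smult_left)

lemma reduced_coeff_eq_0:
  assumes "reduced g R" "g i \<noteq> 0" "degree (g i) \<le> k"
  shows "coeff (coeff R i) k = 0"
  using degree_mod_less'[of "g i" "coeff R i"] assms
  by (cases "coeff R i = 0") (auto simp: reduced_def intro: coeff_eq_0)

text \<open>A standard basis for the lowest order in \<xi>: \<open>lead\<close> describes the ideals
  of leading coefficients, and \<open>high\<close> provides the order \<open>N\<close> at which
  division stops.\<close>

locale leading_generators =
  fixes I :: "poly2 set" and g :: "nat \<Rightarrow> complex poly" and N :: nat
  assumes subspace: "ideal.subspace I"
    and lead: "(\<exists>p\<in>I. (\<forall>m<i. coeff p m = 0) \<and> coeff p i = h) \<longleftrightarrow> g i dvd h"
    and high: "(\<forall>m<N. coeff p m = 0) \<Longrightarrow> p \<in> I"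
    and nonzero: "g i \<noteq> 0"
begin

lemma g_unit:
  assumes "N \<le> i"
  shows "g i dvd 1"
proof -
  have "monom 1 i \<in> I" using assms by (intro high) auto
  then have "\<exists>p\<in>I. (\<forall>m<i. coeff p m = 0) \<and> coeff p i = 1"
    by (intro bexI[of _ "monom 1 i"]) auto
  then show ?thesis by (simp add: lead)
qed

lemma degree_g_0: "N \<le> i \<Longrightarrow> degree (g i) = 0"
  using g_unit by (simp add: is_unit_iff_degree nonzero)

text \<open>Multiplication by \<xi> turns a leading coefficient at order \<open>i\<close> into one
  at order \<open>i + 1\<close>.\<close>

lemma g_Suc_dvd: "g (Suc i) dvd g i"
proof -
  obtain p where p: "p \<in> I" "\<forall>m<i. coeff p m = 0" "coeff p i = g i"
    using lead[of i "g i"] by auto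
  have "xi * p \<in> I" by (rule ideal.subspace_scale[OF subspace p(1)])
  moreover have "\<forall>m<Suc i. coeff (xi * p) m = 0"
    using p(2) by (auto simp: xi_def coeff_pCons split: nat.splits)
  moreover have "coeff (xi * p) (Suc i) = g i"
    using p(3) by (simp add: xi_def)
  ultimately show ?thesis using lead[of "Suc i" "g i"] by blast
qed

text \<open>The lowest nonzero coefficient would be a multiple of \<open>g m\<close> and also its
  own remainder modulo \<open>g m\<close>.\<close>

lemma reduced_in_ideal:
  assumes "reduced g R" "R \<in> I"
  shows "R = 0"
proof (rule ccontr)
  assume "R \<noteq> 0"
  then have "\<exists>m. coeff R m \<noteq> 0" by (auto simp: poly_eq_iff)
  then obtain m where m: "coeff R m \<noteq> 0" "\<forall>k<m. coeff R k = 0"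
    using exists_least_iff[of "\<lambda>m. coeff R m \<noteq> 0"] by auto
  then have "g m dvd coeff R m" using lead assms(2) by blast
  then show False using m(1) assms(1) by (metis reduced_def dvd_imp_mod_0)
qed

text \<open>Division from the lowest order upwards: at order \<open>m\<close> an element of
  \<open>I\<close> removes the quotient part of the coefficient, the remainder is kept, and
  everything from order \<open>N\<close> on lies in \<open>I\<close>.\<close>

lemma ex_reduced:
  assumes "\<forall>k<m. coeff p k = 0"
  shows "\<exists>R. reduced g R \<and> p - R \<in> I \<and> (\<forall>k<m. coeff R k = 0) \<and> coeff R m = coeff p m mod g m"
  using assms
proof (induction "N - m" arbitrary: m p)
  case 0
  then have "p \<in> I" by (intro high) auto
  moreover have "coeff p m mod g m = 0"
    using g_unit[of m] 0 by (metis dvd_imp_mod_0 dvd_trans one_dvd diff_is_0_eq)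
  ultimately show ?case by (intro exI[of _ 0]) auto
next
  case (Suc d)
  obtain q where q: "q \<in> I" "\<forall>k<m. coeff q k = 0" "coeff q m = g m * (coeff p m div g m)"
    using lead[of m "g m * (coeff p m div g m)"] by auto
  define r where "r = coeff p m mod g m"
  have r: "coeff p m - coeff q m = r"
    by (simp add: q(3) r_def minus_mult_div_eq_mod)
  define p' where "p' = p - q - monom r m"
  have "\<forall>k<Suc m. coeff p' k = 0"
    using Suc.prems q(2) r by (auto simp: p'_def less_Suc_eq)
  with Suc.hyps obtain R where R: "reduced g R" "p' - R \<in> I" "\<forall>k<Suc m. coeff R k = 0"
    by (metis Suc_diff_Suc diff_Suc_Suc zero_less_Suc zero_less_diff nat.inject)
  have "p - (R + monom r m) = (p' - R) + q" by (simp add: p'_def algebra_simps)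
  then have "p - (R + monom r m) \<in> I"
    using ideal.subspace_add[OF subspace R(2) q(1)] by (simp only:)
  moreover have "reduced g (R + monom r m)"
    by (intro reduced_add R) (simp add: reduced_def r_def)
  ultimately show ?case
    using R(3) by (intro exI[of _ "R + monom r m"]) (auto simp: r_def)
qed

text \<open>Existence comes from \<open>ex_reduced\<close>, uniqueness from
  \<open>reduced_in_ideal\<close>; uniqueness makes \<open>nf\<close> linear.\<close>

definition nf :: "poly2 \<Rightarrow> poly2" where
  "nf p = (THE R. reduced g R \<and> p - R \<in> I)"

lemma nf_eqI:
  assumes "reduced g R" "p - R \<in> I"
  shows "nf p = R"
  unfolding nf_def
proof (rule the_equality)
  fix S assume S: "reduced g S \<and> p - S \<in> I"
  have "(p - R) - (p - S) \<in> I"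
    using ideal.subspace_diff[OF subspace assms(2), of "p - S"] S by blast
  then have "S - R \<in> I" by simp
  with reduced_in_ideal[of "S - R"] show "S = R"
    using reduced_diff S assms(1) by auto
qed (use assms in auto)

lemma nf: "reduced g (nf p)" "p - nf p \<in> I"
  using ex_reduced[of 0 p] nf_eqI[of _ p] by auto

text \<open>Triangularity of division with respect to the order in \<xi>; the computation of the
  limit rests on it.\<close>

lemma nf_low:
  assumes "\<forall>k<m. coeff p k = 0"
  shows "\<forall>k<m. coeff (nf p) k = 0" "coeff (nf p) m = coeff p m mod g m"
  using ex_reduced[OF assms] nf_eqI[of _ p] by auto

lemma nf_add: "nf (p + q) = nf p + nf q"
proof (rule nf_eqI)
  have "p - nf p + (q - nf q) \<in> I"
    by (intro ideal.subspace_add subspace nf)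
  then show "p + q - (nf p + nf q) \<in> I" by (simp add: algebra_simps)
qed (simp add: reduced_add nf)

lemma nf_smult: "nf (smult [:c:] p) = smult [:c:] (nf p)"
proof (rule nf_eqI)
  have "smult [:c:] (p - nf p) \<in> I"
    by (intro subspace_smult subspace nf)
  then show "smult [:c:] p - smult [:c:] (nf p) \<in> I" by (simp add: smult_diff_right)
qed (simp add: reduced_smult nf)

lemma nf_0: "nf 0 = 0"
  by (rule nf_eqI) (simp_all add: ideal.subspace_0 subspace)

lemma nf_sum: "nf (\<Sum>i\<in>S. f i) = (\<Sum>i\<in>S. nf (f i))"
  by (induction S rule: infinite_finite_induct) (simp_all add: nf_0 nf_add)

lemma finite_staircase: "finite {(i, k). k < degree (g i)}"
proof (rule finite_subset)
  show "{(i, k). k < degree (g i)} \<subseteq> (SIGMA i:{..<N}. {..<degree (g i)})"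
  proof (rule subsetI, clarify)
    fix i k assume k: "k < degree (g i)"
    then have "\<not> N \<le> i" using degree_g_0[of i] by auto
    with k show "i \<in> {..<N} \<and> k \<in> {..<degree (g i)}" by simp
  qed
qed simp

end

section \<open>Monomials below the staircase\<close>

definition monomials :: "(nat \<Rightarrow> nat \<times> nat) \<Rightarrow> nat \<Rightarrow> poly2" where
  "monomials e s = monom (monom 1 (snd (e s))) (fst (e s))"

context leading_generators
begin

context
  fixes n :: nat and e :: "nat \<Rightarrow> nat \<times> nat"
  assumes e: "bij_betw e {..<n} {(i, k). k < degree (g i)}"
begin

lemma coeff_lincomb_monomials:
  "coeff (coeff (lincomb n (monomials e) c) i) k = (\<Sum>s<n. if e s = (i, k) then c s else 0)"
  by (auto simp: coeff_sum monomials_def intro!: sum.cong)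

lemma coeff_lincomb_monomials_at:
  assumes "s < n"
  shows "coeff (coeff (lincomb n (monomials e) c) (fst (e s))) (snd (e s)) = c s"
proof -
  have "(\<Sum>s'<n. if e s' = (fst (e s), snd (e s)) then c s' else 0) = (\<Sum>s'<n. if s' = s then c s' else 0)"
    using e assms by (intro sum.cong) (auto simp: bij_betw_def inj_on_def)
  then show ?thesis using assms by (simp add: coeff_lincomb_monomials)
qed

lemma reduced_lincomb_monomials: "reduced g (lincomb n (monomials e) c)"
  unfolding reduced_def
proof
  fix i
  let ?R = "coeff (lincomb n (monomials e) c) i"
  have 0: "coeff ?R k = 0" if "degree (g i) \<le> k" for k
    unfolding coeff_lincomb_monomials
    using bij_betw_imp_surj_on[OF e] that by (intro sum.neutral) (force dest: equalityD1)
  show "?R mod g i = ?R"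
  proof (cases "?R = 0")
    case False
    then have "degree ?R < degree (g i)"
      using 0 leading_coeff_0_iff not_le by blast
    then show ?thesis by (rule mod_poly_less)
  qed simp
qed

lemma lincomb_monomials_coeff:
  assumes "reduced g R"
  shows "lincomb n (monomials e) (\<lambda>s. coeff (coeff R (fst (e s))) (snd (e s))) = R"
    (is "?L = R")
proof (rule poly_eqI, rule poly_eqI)
  fix i k
  show "coeff (coeff ?L i) k = coeff (coeff R i) k"
  proof (cases "k < degree (g i)")
    case True
    then have "(i, k) \<in> e ` {..<n}"
      using bij_betw_imp_surj_on[OF e] by simp
    then obtain s where "s < n" "e s = (i, k)" by auto
    then show ?thesis using coeff_lincomb_monomials_at[of s "\<lambda>s. coeff (coeff R (fst (e s))) (snd (e s))"] by simp
  next
    case False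
    then show ?thesis
      using reduced_coeff_eq_0[OF assms nonzero] reduced_coeff_eq_0[OF reduced_lincomb_monomials nonzero]
      by (simp add: not_less)
  qed
qed

text \<open>Reduced polynomials are exactly the combinations of these monomials, so the coefficients
  of \<open>nf p\<close> are the coordinates of \<open>p\<close>.\<close>

lemma basis_monomials: "basis_mod UNIV I n (monomials e)"
proof (rule basis_modI[where C = "\<lambda>p s. coeff (coeff (nf p) (fst (e s))) (snd (e s))"])
  fix p
  show "p - lincomb n (monomials e) (\<lambda>s. coeff (coeff (nf p) (fst (e s))) (snd (e s))) \<in> I"
    by (simp only: lincomb_monomials_coeff nf)
next
  fix p c s
  assume "p - lincomb n (monomials e) c \<in> I" "s < n"
  then show "c s = coeff (coeff (nf p) (fst (e s))) (snd (e s))"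
    by (simp add: nf_eqI[OF reduced_lincomb_monomials] coeff_lincomb_monomials_at)
qed simp

lemma coord_monomials:
  assumes "s < n"
  shows "chart_coord n (monomials e) p s I = coeff (coeff (nf p) (fst (e s))) (snd (e s))"
proof (rule basis_mod_coord_unique[OF basis_monomials _ _ assms])
  show "p - lincomb n (monomials e) (\<lambda>s. coeff (coeff (nf p) (fst (e s))) (snd (e s))) \<in> I"
    by (simp only: lincomb_monomials_coeff nf)
qed simp

end

lemma ex_enum:
  obtains e where "bij_betw e {..<card {(i, k). k < degree (g i)}} {(i, k). k < degree (g i)}"
  using ex_bij_betw_nat_finite[OF finite_staircase] by (auto simp: atLeast0LessThan)

lemma card_staircase:
  assumes "I \<in> hilb n"
  shows "n = card {(i, k). k < degree (g i)}"
proof -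
  obtain e where e: "bij_betw e {..<card {(i, k). k < degree (g i)}} {(i, k). k < degree (g i)}"
    by (rule ex_enum)
  show ?thesis
    using assms basis_mod_size_unique[OF subspace _ basis_monomials[OF e]] by (auto simp: hilb_def)
qed

text \<open>Adding multiples of \<open>xi ^ (i + 1)\<close> frees all coefficients beyond the
  \<open>i\<close>-th, so only the condition on the leading one remains.\<close>

lemma graded_piece:
  "{p + q | p q. p \<in> I \<inter> ideal.span {xi ^ i} \<and> q \<in> ideal.span {xi ^ (i + 1)}}
    = {p. (\<forall>m<i. coeff p m = 0) \<and> g i dvd coeff p i}"
proof (intro subset_antisym subsetI)
  fix r assume "r \<in> {p + q | p q. p \<in> I \<inter> ideal.span {xi ^ i} \<and> q \<in> ideal.span {xi ^ (i + 1)}}"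
  then obtain p q where "r = p + q" "p \<in> I" "\<forall>m<i. coeff p m = 0" "\<forall>m<i+1. coeff q m = 0"
    unfolding span_xi by blast
  then show "r \<in> {p. (\<forall>m<i. coeff p m = 0) \<and> g i dvd coeff p i}"
    using lead[of i "coeff p i"] by auto
next
  fix p assume "p \<in> {p. (\<forall>m<i. coeff p m = 0) \<and> g i dvd coeff p i}"
  then have p: "\<forall>m<i. coeff p m = 0" "g i dvd coeff p i" by auto
  then obtain q where q: "q \<in> I" "\<forall>m<i. coeff q m = 0" "coeff q i = coeff p i"
    using lead by blast
  then have "p = q + (p - q)" "\<forall>m<i+1. coeff (p - q) m = 0"
    using p by (auto simp: less_Suc_eq)
  with q show "p \<in> {p + q | p q. p \<in> I \<inter> ideal.span {xi ^ i} \<and> q \<in> ideal.span {xi ^ (i + 1)}}"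
    unfolding span_xi by blast
qed

text \<open>Taking the coefficient of \<open>xi ^ i\<close> identifies the quotient with
  \<open>\<complex>[z] / (g i)\<close>, whose basis consists of the powers of \<open>z\<close> below
  the degree of \<open>g i\<close>.\<close>

lemma lambda'_eq: "lambda' I i = degree (g i)"
proof -
  let ?A = "{p. \<forall>m<i. coeff p m = 0} :: poly2 set"
  let ?B = "{p. (\<forall>m<i. coeff p m = 0) \<and> g i dvd coeff p i}"
  let ?f = "\<lambda>k. monom (monom 1 k) i :: poly2"
  have low: "coeff (lincomb d ?f c) m = 0" if "m < i" for c m d
    using that by (auto simp: coeff_sum)
  have at: "coeff (coeff (lincomb d ?f c) i) k = (if k < d then c k else 0)" for c k d
    by (simp add: coeff_sum if_distrib[of "\<lambda>x. _ * x"] cong: if_cong)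
  have sub: "ideal.subspace ?B"
  proof -
    \<comment> \<open>Only \<open>coeff c 0 * coeff p i\<close> survives, as \<open>p\<close> has no
      coefficients below \<open>i\<close>.\<close>
    have "g i dvd coeff (c * p) i" if "\<forall>m<i. coeff p m = 0" "g i dvd coeff p i" for c p
      unfolding coeff_mult
    proof (rule dvd_sum)
      fix j assume "j \<in> {..i}"
      then show "g i dvd coeff c j * coeff p (i - j)"
        using that by (cases "j = 0") auto
    qed
    moreover have "coeff (c * p) m = 0" if "\<forall>m<i. coeff p m = 0" "m < i" for c p m
      unfolding coeff_mult using that by (intro sum.neutral) auto
    ultimately show ?thesis
      by (auto simp: ideal.subspace_def)
  qed
  have "basis_mod ?A ?B (degree (g i)) ?f"
  proof (rule basis_modI[where C = "\<lambda>p k. coeff (coeff p i mod g i) k"])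
    fix p assume p: "p \<in> ?A"
    have "coeff (lincomb (degree (g i)) ?f (\<lambda>k. coeff (coeff p i mod g i) k)) i = coeff p i mod g i"
    proof (rule poly_eqI)
      fix k
      show "coeff (coeff (lincomb (degree (g i)) ?f (\<lambda>k. coeff (coeff p i mod g i) k)) i) k
          = coeff (coeff p i mod g i) k"
        unfolding at using degree_mod_less[OF nonzero, of "coeff p i" i]
        by (cases "coeff p i mod g i = 0") (auto simp: coeff_eq_0)
    qed
    moreover have "g i dvd coeff p i - coeff p i mod g i"
      by (simp add: minus_mod_eq_mult_div)
    ultimately show "p - lincomb (degree (g i)) ?f (\<lambda>k. coeff (coeff p i mod g i) k) \<in> ?B"
      using p low by simp
  next
    fix p c k
    assume "p - lincomb (degree (g i)) ?f c \<in> ?B" and k: "k < degree (g i)"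
    define r where "r = coeff (lincomb (degree (g i)) ?f c) i"
    have dvd: "g i dvd coeff p i - r"
      using \<open>_ \<in> ?B\<close> by (simp add: r_def)
    have "r = 0 \<or> degree r < degree (g i)"
      using at[where d = "degree (g i)" and c = c and k = "degree r"] unfolding r_def[symmetric]
      by (metis leading_coeff_0_iff)
    then have "r mod g i = r" by (auto intro: mod_poly_less)
    then have "r = coeff p i mod g i"
      using dvd by (metis mod_eq_dvd_iff)
    then show "c k = coeff (coeff p i mod g i) k"
      using at[where d = "degree (g i)" and c = c and k = k] k by (simp add: r_def)
  qed auto
  from quot_dim_eq[OF sub this] show ?thesis
    unfolding lambda'_def graded_piece by (simp add: span_xi)
qed

end

section \<open>Convergence to the initial ideal\<close>

definition initial_ideal :: "(nat \<Rightarrow> complex poly) \<Rightarrow> poly2 set" where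
  "initial_ideal g = {p. \<forall>i. g i dvd coeff p i}"

text \<open>The divisibility chain permits multiplication by powers of \<xi>:
  \<open>coeff p (i - j)\<close> is divisible by \<open>g (i - j)\<close>, hence by
  \<open>g i\<close>.\<close>

lemma subspace_initial_ideal:
  assumes "\<And>i. g (Suc i) dvd g i"
  shows "ideal.subspace (initial_ideal g)"
proof -
  have anti: "g j dvd g i" if "i \<le> j" for i j
    using that by (induction rule: dec_induct) (auto intro: dvd_trans assms)
  have "g i dvd coeff (c * p) i" if "\<forall>i. g i dvd coeff p i" for c p i
    unfolding coeff_mult
  proof (intro dvd_sum dvd_mult)
    fix j assume "j \<in> {..i}"
    show "g i dvd coeff p (i - j)"
      using anti[of "i - j" i] that by (auto intro: dvd_trans)
  qed
  then show ?thesis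
    by (auto simp: ideal.subspace_def initial_ideal_def)
qed

section \<open>The torus action and its limit\<close>

lemma act_eq: "p \<in> act t I \<longleftrightarrow> pcompose p [:0, [:t:]:] \<in> I"
  by (simp add: act_def)

lemma coeff_act: "coeff (pcompose (p :: poly2) [:0, [:t:]:]) i = smult (t ^ i) (coeff p i)"
proof -
  have "[:t:] ^ i = [:t ^ i:]" by (induction i) (simp_all add: one_pCons)
  then show ?thesis by (simp add: coeff_pcompose_linear)
qed

lemma act_initial_ideal:
  assumes "t \<noteq> 0"
  shows "act t (initial_ideal g) = initial_ideal g"
  using assms by (auto simp: act_eq initial_ideal_def coeff_act dvd_smult_iff)

lemma subspace_act:
  assumes "ideal.subspace I"
  shows "ideal.subspace (act t I)"
  using assms by (auto simp: ideal.subspace_def act_eq pcompose_add pcompose_mult pcompose_0)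

context leading_generators
begin

text \<open>Together with \<open>leading_act\<close> this shows that all \<open>act t I\<close> with
  \<open>t \<noteq> 0\<close> and their limit share the same \<open>g\<close>, hence one common
  monomial basis.\<close>

lemma leading_initial_ideal: "leading_generators (initial_ideal g) g N"
proof
  show "ideal.subspace (initial_ideal g)"
    by (rule subspace_initial_ideal) (rule g_Suc_dvd)
  show "(\<exists>p\<in>initial_ideal g. (\<forall>m<i. coeff p m = 0) \<and> coeff p i = h) \<longleftrightarrow> g i dvd h" for i h
  proof
    assume "g i dvd h"
    then show "\<exists>p\<in>initial_ideal g. (\<forall>m<i. coeff p m = 0) \<and> coeff p i = h"
      by (intro bexI[of _ "monom h i"]) (auto simp: initial_ideal_def)
  qed (auto simp: initial_ideal_def)
  show "p \<in> initial_ideal g" if "\<forall>m<N. coeff p m = 0" for p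
    unfolding initial_ideal_def
  proof (intro CollectI allI)
    fix i show "g i dvd coeff p i"
      using that g_unit[of i] by (cases "i < N") (auto intro: unit_imp_dvd)
  qed
qed (rule nonzero)

text \<open>The substitution preserves the order in \<xi> and multiplies the coefficient of
  \<open>\<xi>\<^sup>i\<close> by the unit \<open>t ^ i\<close>.\<close>

lemma leading_act:
  assumes t: "t \<noteq> 0"
  shows "leading_generators (act t I) g N"
proof
  show "ideal.subspace (act t I)" by (rule subspace_act[OF subspace])
  show "(\<exists>p\<in>act t I. (\<forall>m<i. coeff p m = 0) \<and> coeff p i = h) \<longleftrightarrow> g i dvd h" for i h
  proof
    assume "\<exists>p\<in>act t I. (\<forall>m<i. coeff p m = 0) \<and> coeff p i = h"
    then obtain p where p: "p \<in> act t I" "\<forall>m<i. coeff p m = 0" "coeff p i = h" by blast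
    then have "g i dvd coeff (pcompose p [:0, [:t:]:]) i"
      using lead[of i "coeff (pcompose p [:0, [:t:]:]) i"]
      by (metis act_eq coeff_act smult_0_right)
    then show "g i dvd h" using t p by (simp add: coeff_act dvd_smult_iff)
  next
    assume "g i dvd h"
    then obtain q where q: "q \<in> I" "\<forall>m<i. coeff q m = 0" "coeff q i = smult (t ^ i) h"
      using lead[of i "smult (t ^ i) h"] by (auto intro: dvd_smult)
    define p where "p = pcompose q [:0, [:inverse t:]:]"
    have "pcompose p [:0, [:t:]:] = q"
      using t by (intro poly_eqI) (simp add: p_def coeff_act flip: power_mult_distrib)
    moreover have "coeff p i = h"
      using t by (simp add: p_def coeff_act q flip: power_mult_distrib)
    moreover have "\<forall>m<i. coeff p m = 0" using q by (simp add: p_def coeff_act)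
    ultimately show "\<exists>p\<in>act t I. (\<forall>m<i. coeff p m = 0) \<and> coeff p i = h"
      using q(1) by (auto simp: act_eq)
  qed
  show "p \<in> act t I" if "\<forall>m<N. coeff p m = 0" for p
    using that unfolding act_eq by (intro high) (simp add: coeff_act)
qed (rule nonzero)

text \<open>The initial ideal is graded by powers of \<xi>, so division by it acts on each
  coefficient separately.\<close>

lemma nf_initial_ideal:
  "coeff (leading_generators.nf (initial_ideal g) g p) i = coeff p i mod g i"
proof -
  interpret J: leading_generators "initial_ideal g" g N by (rule leading_initial_ideal)
  have "g i dvd coeff p i - coeff (J.nf p) i"
    using J.nf(2)[of p] by (auto simp: initial_ideal_def)
  then have "coeff p i mod g i = coeff (J.nf p) i mod g i" by (simp add: mod_eq_dvd_iff)
  with J.nf(1)[of p] show ?thesis by (simp add: reduced_def)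
qed

text \<open>The substitution carries normal forms modulo \<open>act t I\<close> to normal forms
  modulo \<open>I\<close>; splitting \<open>p\<close> into its terms in \<open>\<xi>\<^sup>m\<close>
  makes the dependence on \<open>t\<close> explicit.\<close>

lemma nf_act:
  assumes t: "t \<noteq> 0"
  shows "smult (t ^ i) (coeff (leading_generators.nf (act t I) g p) i)
    = (\<Sum>m\<le>degree p. smult (t ^ m) (coeff (nf (monom (coeff p m) m)) i))"
proof -
  interpret T: leading_generators "act t I" g N by (rule leading_act[OF t])
  let ?c = "\<lambda>p. pcompose p [:0, [:t:]:] :: poly2"
  have "reduced g (?c (T.nf p))"
    using T.nf(1)[of p] by (simp add: reduced_def coeff_act mod_smult_left)
  moreover have "?c p - ?c (T.nf p) \<in> I"
    using T.nf(2)[of p] by (simp add: act_eq pcompose_diff)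
  ultimately have "nf (?c p) = ?c (T.nf p)" by (rule nf_eqI)
  then have "smult (t ^ i) (coeff (T.nf p) i) = coeff (nf (?c p)) i"
    by (simp add: coeff_act)
  also have "?c p = (\<Sum>m\<le>degree p. smult [:t ^ m:] (monom (coeff p m) m))"
    by (rule poly_eqI) (auto simp: coeff_act coeff_sum coeff_eq_0 not_le if_distrib[of "smult _"] cong: if_cong)
  also have "coeff (nf \<dots>) i = (\<Sum>m\<le>degree p. smult (t ^ m) (coeff (nf (monom (coeff p m) m)) i))"
    by (simp add: nf_sum nf_smult coeff_sum)
  finally show ?thesis .
qed

text \<open>Normal forms of the terms of order above \<open>i\<close> in \<open>\<xi>\<close> do not involve \<open>\<xi>\<^sup>i\<close>, hence only
  nonpositive powers of \<open>t\<close> survive.\<close>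

lemma tendsto_nf_act:
  "((\<lambda>t. coeff (coeff (leading_generators.nf (act t I) g p) i) k) \<longlongrightarrow> coeff (coeff p i mod g i) k) at_infinity"
proof -
  let ?a = "\<lambda>m. coeff (coeff (nf (monom (coeff p m) m)) i) k"
  have hi: "?a m = 0" if "m > i" for m
    using nf_low(1)[of m "monom (coeff p m) m"] that by simp
  have eq: "?a i = coeff (coeff p i mod g i) k"
    using nf_low(2)[of i "monom (coeff p i) i"] by simp
  \<comment> \<open>The case split avoids truncation in \<open>i - m\<close>: for
    \<open>m > i\<close> the term is zero by \<open>hi\<close>.\<close>
  have "((\<lambda>t. if m > i then 0 else ?a m * inverse t ^ (i - m)) \<longlongrightarrow> (if m = i then ?a i else 0)) at_infinity" for m
  proof (cases m i rule: linorder_cases)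
    case less
    have "((\<lambda>t. ?a m * inverse t ^ (i - m)) \<longlongrightarrow> ?a m * 0 ^ (i - m)) at_infinity"
      by (intro tendsto_intros tendsto_inverse_0)
    moreover have "?a m * 0 ^ (i - m) = 0" using less by (simp add: power_0_left)
    ultimately show ?thesis using less by simp
  qed auto
  then have "((\<lambda>t. \<Sum>m\<le>degree p. if m > i then 0 else ?a m * inverse t ^ (i - m))
      \<longlongrightarrow> (\<Sum>m\<le>degree p. if m = i then ?a i else 0)) at_infinity"
    by (intro tendsto_sum)
  \<comment> \<open>If \<open>i\<close> exceeds \<open>degree p\<close>, no summand survives and
    \<open>coeff p i\<close> is zero as well.\<close>
  moreover have "(\<Sum>m\<le>degree p. if m = i then ?a i else 0) = coeff (coeff p i mod g i) k"
    by (auto simp: eq coeff_eq_0 not_le)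
  moreover have "\<forall>\<^sub>F t in at_infinity. (\<Sum>m\<le>degree p. if m > i then 0 else ?a m * inverse t ^ (i - m))
      = coeff (coeff (leading_generators.nf (act t I) g p) i) k"
  proof -
    have "\<forall>\<^sub>F t::complex in at_infinity. t \<noteq> 0"
      by (rule eventually_not_equal_at_infinity)
    then show ?thesis
    proof eventually_elim
      case (elim t)
      have "t ^ i * coeff (coeff (leading_generators.nf (act t I) g p) i) k = (\<Sum>m\<le>degree p. t ^ m * ?a m)"
        using arg_cong[OF nf_act[OF elim, of i p], of "\<lambda>q. coeff q k"] by (simp add: coeff_sum)
      also have "\<dots> = (\<Sum>m\<le>degree p. t ^ i * (if m > i then 0 else ?a m * inverse t ^ (i - m)))"
        using elim by (intro sum.cong refl) (auto simp: hi power_diff field_simps)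
      finally show ?case
        using elim by (simp flip: sum_distrib_left)
    qed
  qed
  ultimately show ?thesis
    using tendsto_cong by force
qed

text \<open>The monomials below the staircase give a chart containing the initial ideal and every
  \<open>act t I\<close> with \<open>t \<noteq> 0\<close>, so convergence of the normal forms
  suffices.\<close>

lemma limitin_act:
  assumes "I \<in> hilb n"
  shows "initial_ideal g \<in> hilb n"
    and "limitin (classical n) (\<lambda>t. act t I) (initial_ideal g) at_infinity"
proof -
  interpret J: leading_generators "initial_ideal g" g N by (rule leading_initial_ideal)
  obtain e where e: "bij_betw e {..<n} {(i, k). k < degree (g i)}"
    using ex_enum card_staircase[OF assms] by metis
  have J: "initial_ideal g \<in> chart n (monomials e)"
    using J.basis_monomials[OF e] J.subspace by (auto intro: chartI)
  then show "initial_ideal g \<in> hilb n" by (simp add: chart_def)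
  have nz: "\<forall>\<^sub>F t::complex in at_infinity. t \<noteq> 0"
    by (rule eventually_not_equal_at_infinity)
  show "limitin (classical n) (\<lambda>t. act t I) (initial_ideal g) at_infinity"
  proof (rule limitin_classicalI[OF _ J])
    show "\<forall>\<^sub>F t in at_infinity. act t I \<in> chart n (monomials e)"
      using nz by eventually_elim
        (intro chartI leading_generators.basis_monomials[OF leading_act e] leading_generators.subspace[OF leading_act])
  next
    fix p s assume s: "s < n"
    have "\<forall>\<^sub>F t in at_infinity. coeff (coeff (leading_generators.nf (act t I) g p) (fst (e s))) (snd (e s))
        = chart_coord n (monomials e) p s (act t I)"
      using nz by eventually_elim
        (simp add: leading_generators.coord_monomials[OF leading_act e s])
    with tendsto_nf_act show "((\<lambda>t. chart_coord n (monomials e) p s (act t I)) \<longlongrightarrow>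
        chart_coord n (monomials e) p s (initial_ideal g)) at_infinity"
      unfolding J.coord_monomials[OF e s] nf_initial_ideal by (rule Lim_transform_eventually)
  qed
qed

end

section \<open>Ideals supported on the line\<close>

text \<open>Euclidean division by a nonzero element of least degree; for \<open>S = {0}\<close> the
  generator is \<open>0\<close>.\<close>

lemma poly_ideal_principal:
  fixes S :: "'a::field poly set"
  assumes "0 \<in> S" and add: "\<And>x y. x \<in> S \<Longrightarrow> y \<in> S \<Longrightarrow> x + y \<in> S"
    and mult: "\<And>c x. x \<in> S \<Longrightarrow> c * x \<in> S"
  shows "\<exists>d. \<forall>h. h \<in> S \<longleftrightarrow> d dvd h"
proof (cases "S \<subseteq> {0}")
  case True
  then show ?thesis using assms(1) by (intro exI[of _ 0]) auto
next
  case False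
  then obtain d where d: "d \<in> S" "d \<noteq> 0" and
    least: "\<And>x. x \<in> S \<Longrightarrow> x \<noteq> 0 \<Longrightarrow> degree d \<le> degree x"
    using ex_has_least_nat[of "\<lambda>x. x \<in> S \<and> x \<noteq> 0" _ degree] by blast
  have "d dvd h" if h: "h \<in> S" for h
  proof -
    have "h + (- (h div d)) * d \<in> S" by (intro add mult h d)
    then have "h mod d \<in> S" by (simp add: minus_div_mult_eq_mod)
    then show ?thesis
      using least[of "h mod d"] degree_mod_less[OF d(2), of h]
      by (metis mod_eq_0_iff_dvd not_le)
  qed
  moreover have "h \<in> S" if "d dvd h" for h
    using that mult[OF d(1)] by (auto simp: dvd_def mult.commute)
  ultimately show ?thesis by blast
qed

text \<open>A Nullstellensatz on the line \<xi> = b: restriction to it sends \<open>I\<close> to an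
  ideal of \<open>\<complex>[z]\<close> whose generator has no root and so is a unit. Hence \<xi> -
  b is invertible modulo \<open>I\<close>.\<close>

lemma poly2_mod_xi_minus_unit:
  assumes I: "ideal.subspace I" and no_zero: "\<And>a. \<exists>p\<in>I. eval2 p a b \<noteq> 0"
  obtains q u where "q \<in> I" "1 = q + [:- [:b:], 1:] * u"
proof -
  let ?S = "(\<lambda>q. poly q [:b:]) ` I"
  have "0 \<in> ?S" using ideal.subspace_0[OF I] by force
  moreover have "x + y \<in> ?S" if "x \<in> ?S" "y \<in> ?S" for x y
    using that ideal.subspace_add[OF I] by (auto simp flip: poly_add)
  moreover have "c * x \<in> ?S" if x: "x \<in> ?S" for c x
  proof -
    obtain q where "q \<in> I" "x = poly q [:b:]" using x by blast
    then have "[:c:] * q \<in> I" "c * x = poly ([:c:] * q) [:b:]"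
      using ideal.subspace_scale[OF I, of q "[:c:]"] by auto
    then show ?thesis by blast
  qed
  ultimately obtain d where d: "\<And>h. h \<in> ?S \<longleftrightarrow> d dvd h"
    using poly_ideal_principal[of ?S] by blast
  have noroot: "poly d a \<noteq> 0" for a
  proof
    assume "poly d a = 0"
    then have "eval2 p a b = 0" if "p \<in> I" for p
      using d[of "poly p [:b:]"] that by (auto simp: eval2_def dvd_def)
    with no_zero[of a] show False by blast
  qed
  then have "constant (poly d)" using fundamental_theorem_of_algebra by blast
  then have "degree d = 0" by (simp add: constant_degree)
  moreover have "d \<noteq> 0" using noroot by auto
  ultimately have "d dvd 1" by (simp add: is_unit_iff_degree)
  then obtain q where q: "q \<in> I" "poly q [:b:] = 1" using d[of 1] by auto
  then have "poly (1 - q) [:b:] = 0" by simp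
  then have "[:- [:b:], 1:] dvd 1 - q" by (simp only: poly_eq_0_iff_dvd)
  then obtain u where "1 - q = [:- [:b:], 1:] * u" by (auto simp: dvd_def)
  then have "1 = q + [:- [:b:], 1:] * u" by (simp add: algebra_simps)
  with q that show ?thesis by blast
qed

text \<open>Here \<open>P\<close> is read as a polynomial in \<xi>, and its linear factors are
  removed one at a time: a root \<open>0\<close> raises the exponent \<open>M\<close>, and a factor
  \<xi> - b with b \<noteq> 0 is invertible modulo \<open>I\<close>.\<close>

lemma xi_power_in_ideal_if_poly_in_ideal:
  fixes P :: "complex poly"
  assumes I: "ideal.subspace I" and supp: "\<And>a b. b \<noteq> 0 \<Longrightarrow> \<exists>p\<in>I. eval2 p a b \<noteq> 0"
    and "P \<noteq> 0" "map_poly (\<lambda>c. [:c:]) P * xi ^ M \<in> I"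
  shows "\<exists>N. xi ^ N \<in> I"
  using assms(3,4)
proof (induction "degree P" arbitrary: P M)
  case 0
  then obtain c where c: "P = [:c:]" "c \<noteq> 0" by (metis degree_eq_zeroE pCons_0_0)
  then have "smult [:c:] (xi ^ M) \<in> I" using 0 by (simp add: map_poly_pCons)
  then have "smult [:inverse c:] (smult [:c:] (xi ^ M)) \<in> I" by (rule subspace_smult[OF I])
  then show ?case using c by (auto simp flip: one_pCons)
next
  case (Suc d)
  have "\<not> constant (poly P)" using Suc.hyps(2) by (simp add: constant_degree)
  then obtain b where "poly P b = 0" using fundamental_theorem_of_algebra by blast
  then obtain P' where P': "P = [:- b, 1:] * P'" by (auto simp: poly_eq_0_iff_dvd dvd_def)
  have "P' \<noteq> 0" using P' Suc by auto
  then have deg: "d = degree P'"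
    using Suc.hyps(2) unfolding P' by (subst (asm) degree_mult_eq) auto
  have emb: "map_poly (\<lambda>c. [:c:]) P = [:- [:b:], 1:] * map_poly (\<lambda>c. [:c:]) P'"
    by (rule poly_eqI) (simp add: P' coeff_map_poly coeff_pCons split: nat.splits)
  let ?Q = "map_poly (\<lambda>c. [:c:]) P'"
  show ?case
  proof (cases "b = 0")
    case True
    then have "map_poly (\<lambda>c. [:c:]) P * xi ^ M = ?Q * xi ^ Suc M"
      by (simp add: emb xi_def ac_simps)
    then show ?thesis using Suc.hyps(1)[OF deg \<open>P' \<noteq> 0\<close>] Suc.prems(2) by metis
  next
    case False
    then obtain q u where q: "q \<in> I" "1 = q + [:- [:b:], 1:] * u"
      using poly2_mod_xi_minus_unit[OF I supp] by blast
    \<comment> \<open>Multiplying \<open>1 = q + (\<xi> - b) u\<close> by \<open>?Q * xi ^ M\<close>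
      writes the latter as a sum of two elements of \<open>I\<close>.\<close>
    have "(?Q * xi ^ M) * q + u * (map_poly (\<lambda>c. [:c:]) P * xi ^ M) \<in> I"
      by (intro ideal.subspace_add[OF I] ideal.subspace_scale[OF I] q Suc.prems)
    also have "(?Q * xi ^ M) * q + u * (map_poly (\<lambda>c. [:c:]) P * xi ^ M)
        = (q + [:- [:b:], 1:] * u) * (?Q * xi ^ M)"
      unfolding emb by (simp only: algebra_simps)
    also have "\<dots> = ?Q * xi ^ M" by (simp only: q(2)[symmetric] mult_1_left)
    finally show ?thesis by (rule Suc.hyps(1)[OF deg \<open>P' \<noteq> 0\<close>])
  qed
qed

text \<open>The powers of \<open>z\<close> up to \<open>z ^ n\<close> are dependent modulo an ideal
  of colength \<open>n\<close>.\<close>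

lemma ex_poly_z_in_ideal:
  assumes "I \<in> hilb n"
  obtains P where "P \<noteq> 0" "[:P:] \<in> I"
proof -
  obtain f where f: "basis_mod UNIV I n f" using assms by (auto simp: hilb_def)
  obtain c k where k: "k \<le> n" "c k \<noteq> 0" and
    mem: "(\<Sum>k\<le>n. smult [:c k:] [:monom 1 k:]) \<in> I"
    using mod_dependent[OF subspace_hilb[OF assms] f, where v = "\<lambda>k. [:monom 1 k:]"] by metis
  have "(\<Sum>k\<le>n. smult [:c k:] [:monom 1 k:]) = [:\<Sum>k\<le>n. monom (c k) k:]"
    by (rule poly_eqI) (auto simp: coeff_sum coeff_pCons smult_monom split: nat.splits)
  moreover have "coeff (\<Sum>k\<le>n. monom (c k) k) k = c k"
    using k by (simp add: coeff_sum)
  ultimately show ?thesis using that mem k by (metis coeff_0)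
qed

lemma ex_poly_xi_in_ideal:
  assumes "I \<in> hilb n"
  obtains P where "P \<noteq> 0" "map_poly (\<lambda>c. [:c:]) P \<in> I"
proof -
  obtain f where f: "basis_mod UNIV I n f" using assms by (auto simp: hilb_def)
  obtain c k where k: "k \<le> n" "c k \<noteq> 0" and
    mem: "(\<Sum>k\<le>n. smult [:c k:] (monom 1 k)) \<in> I"
    using mod_dependent[OF subspace_hilb[OF assms] f, where v = "monom 1"] by metis
  have "(\<Sum>k\<le>n. smult [:c k:] (monom 1 k)) = map_poly (\<lambda>c. [:c:]) (\<Sum>k\<le>n. monom (c k) k)"
    by (rule poly_eqI) (auto simp: coeff_sum coeff_map_poly if_distrib[of "\<lambda>x. _ * x"] cong: if_cong)
  moreover have "coeff (\<Sum>k\<le>n. monom (c k) k) k = c k"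
    using k by (simp add: coeff_sum)
  ultimately show ?thesis using that mem k by (metis coeff_0)
qed

lemma xi_power_in_LstarC:
  assumes "I \<in> LstarC n"
  obtains N where "xi ^ N \<in> I"
proof -
  from assms have I: "I \<in> hilb n" by (simp add: LstarC_def)
  obtain P where "P \<noteq> 0" "map_poly (\<lambda>c. [:c:]) P \<in> I"
    by (rule ex_poly_xi_in_ideal[OF I])
  moreover have "\<exists>p\<in>I. eval2 p a b \<noteq> 0" if "b \<noteq> 0" for a b
    using assms that by (auto simp: LstarC_def)
  ultimately show ?thesis
    using xi_power_in_ideal_if_poly_in_ideal[OF subspace_hilb[OF I], of P 0] that by auto
qed

text \<open>The leading coefficients of each order form an ideal of \<open>\<complex>[z]\<close>,
  hence a principal one. A nonzero \<open>P\<close> in \<open>z\<close> lying in \<open>I\<close> is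
  a multiple of each \<open>g i\<close>, so \<open>g i\<close> is nonzero; a power of \<xi> in
  \<open>I\<close> provides \<open>N\<close>.\<close>

lemma LstarC_leading_generators:
  assumes "I \<in> LstarC n"
  obtains g N where "leading_generators I g N"
proof -
  from assms have hilb: "I \<in> hilb n" by (simp add: LstarC_def)
  note I = subspace_hilb[OF hilb]
  obtain N where N: "xi ^ N \<in> I" by (rule xi_power_in_LstarC[OF assms])
  obtain P where P: "P \<noteq> 0" "[:P:] \<in> I" by (rule ex_poly_z_in_ideal[OF hilb])
  have "\<exists>d. \<forall>h. (\<exists>p\<in>I. (\<forall>m<i. coeff p m = 0) \<and> coeff p i = h) \<longleftrightarrow> d dvd h" for i
  proof -
    let ?S = "{h. \<exists>p\<in>I. (\<forall>m<i. coeff p m = 0) \<and> coeff p i = h}"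
    have "0 \<in> ?S" using ideal.subspace_0[OF I] by (auto intro: bexI[of _ 0])
    moreover have "x + y \<in> ?S" if xy: "x \<in> ?S" "y \<in> ?S" for x y
    proof -
      obtain p q where "p \<in> I" "\<forall>m<i. coeff p m = 0" "coeff p i = x"
        and "q \<in> I" "\<forall>m<i. coeff q m = 0" "coeff q i = y"
        using xy by blast
      then show ?thesis
        using ideal.subspace_add[OF I, of p q] by (intro CollectI bexI[of _ "p + q"]) auto
    qed
    moreover have "c * x \<in> ?S" if x: "x \<in> ?S" for c x
    proof -
      obtain p where "p \<in> I" "\<forall>m<i. coeff p m = 0" "coeff p i = x"
        using x by blast
      then show ?thesis
        using subspace_smult[OF I, of p c] by (intro CollectI bexI[of _ "smult c p"]) auto
    qed
    ultimately have "\<exists>d. \<forall>h. h \<in> ?S \<longleftrightarrow> d dvd h"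
      by (rule poly_ideal_principal)
    then show ?thesis by simp
  qed
  then obtain g where g:
    "\<And>i h. (\<exists>p\<in>I. (\<forall>m<i. coeff p m = 0) \<and> coeff p i = h) \<longleftrightarrow> g i dvd h"
    by metis
  have "g i \<noteq> 0" for i
  proof -
    have "xi ^ i * [:P:] \<in> I" by (rule ideal.subspace_scale[OF I P(2)])
    then have "monom P i \<in> I" by (simp add: xi_power smult_monom)
    then have "g i dvd P" unfolding g[symmetric] by (intro bexI[of _ "monom P i"]) auto
    with P(1) show ?thesis by auto
  qed
  moreover have "p \<in> I" if "\<forall>m<N. coeff p m = 0" for p
  proof -
    have "p \<in> ideal.span {xi ^ N}" using that by (simp add: span_xi)
    then show ?thesis using ideal.span_minimal[of "{xi ^ N}" I] N I by auto
  qed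
  ultimately have "leading_generators I g N"
    using I g by unfold_locales
  then show ?thesis by (rule that)
qed

section \<open>Young diagrams\<close>

text \<open>Since \<open>Q\<close> does not vanish at \<open>a\<close>, the whole multiplicity of
  \<open>a\<close> in \<open>h\<close> lies in the cofactor of \<open>Q\<close>.\<close>

lemma linear_power_mult_dvd:
  fixes Q h :: "'a::idom poly"
  assumes "[:- a, 1:] ^ m dvd h" "Q dvd h" "poly Q a \<noteq> 0"
  shows "[:- a, 1:] ^ m * Q dvd h"
proof (cases "h = 0")
  case False
  obtain u where u: "h = Q * u" using assms(2) by (auto simp: dvd_def)
  have "m \<le> order a h" using assms(1) False by (simp add: order_divides)
  also have "order a h = order a u"
    using False assms(3) unfolding u by (simp add: order_mult order_0I)
  finally have "[:- a, 1:] ^ m dvd u" by (simp add: order_divides)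
  then show ?thesis unfolding u by (simp add: mult.commute mult_dvd_mono)
qed simp

lemma prod_linear_powers_dvd_iff:
  fixes e :: "'i \<Rightarrow> nat" and a :: "'i \<Rightarrow> complex"
  assumes "finite A" "inj_on a A"
  shows "(\<Prod>j\<in>A. [:- a j, 1:] ^ e j) dvd h \<longleftrightarrow> (\<forall>j\<in>A. [:- a j, 1:] ^ e j dvd h)"
  using assms
proof (induction A rule: finite_induct)
  case (insert x A)
  have "poly (\<Prod>j\<in>A. [:- a j, 1:] ^ e j) (a x) \<noteq> 0"
    using insert by (auto simp: poly_prod poly_power)
  then have "[:- a x, 1:] ^ e x * (\<Prod>j\<in>A. [:- a j, 1:] ^ e j) dvd h \<longleftrightarrow>
      [:- a x, 1:] ^ e x dvd h \<and> (\<Prod>j\<in>A. [:- a j, 1:] ^ e j) dvd h"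
    using linear_power_mult_dvd by (blast dest: dvd_mult_left dvd_mult_right)
  then show ?case
    using insert by simp
qed simp

lemma degree_prod_linear_powers:
  fixes a :: "'i \<Rightarrow> complex"
  shows "degree (\<Prod>j\<in>A. [:- a j, 1:] ^ e j) = (\<Sum>j\<in>A. e j)"
proof -
  have "degree ([:- a j, 1:] ^ e j) = e j" for j
    by (rule degree_linear_power)
  then show ?thesis
    by (subst degree_prod_eq_sum_degree) auto
qed

text \<open>Up to a constant \<open>p\<close> is the product of its root factors, and points
  \<open>a j\<close> that are not roots contribute exponent \<open>0\<close>. So the roots of
  \<open>g 0\<close> can serve for every \<open>g i\<close>.\<close>

lemma prod_linear_powers_dvd_order:
  fixes p :: "complex poly"
  assumes "p \<noteq> 0" "finite A" "inj_on a A" "{z. poly p z = 0} \<subseteq> a ` A"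
  shows "(\<Prod>j\<in>A. [:- a j, 1:] ^ order (a j) p) dvd h \<longleftrightarrow> p dvd h"
proof -
  have "(\<Prod>j\<in>A. [:- a j, 1:] ^ order (a j) p) = (\<Prod>z\<in>a ` A. [:- z, 1:] ^ order z p)"
    using assms(3) by (simp add: prod.reindex)
  also have "\<dots> = (\<Prod>z|poly p z = 0. [:- z, 1:] ^ order z p)"
    using assms by (intro prod.mono_neutral_right) (auto simp: order_root)
  finally have eq: "smult (lead_coeff p) (\<Prod>j\<in>A. [:- a j, 1:] ^ order (a j) p) = p"
    by (simp only: complex_poly_decompose)
  have "smult (lead_coeff p) q dvd h \<longleftrightarrow> q dvd h" for q
    using assms(1) by (simp add: smult_dvd_iff)
  from this[of "\<Prod>j\<in>A. [:- a j, 1:] ^ order (a j) p"] show ?thesis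
    unfolding eq by blast
qed

text \<open>The set counted is an initial segment because \<open>l\<close> is antitone, so its
  cardinality is a threshold. This symmetry of the diagram yields that conjugation is an
  involution.\<close>

lemma conjugate_partition_less_iff:
  assumes "partition_seq l"
  shows "j < conjugate_partition l i \<longleftrightarrow> i < l j"
proof -
  let ?S = "{j. i + 1 \<le> l j}"
  have "?S \<subseteq> {j. l j \<noteq> 0}" by auto
  then have fin: "finite ?S"
    using assms by (auto simp: partition_seq_def dest: finite_subset)
  have down: "k \<in> ?S" if "j \<in> ?S" "k \<le> j" for j k
  proof -
    have "antimono l" using assms by (simp add: partition_seq_def)
    then have "l j \<le> l k" using that(2) by (rule antimonoD)
    with that(1) show ?thesis by simp
  qed
  have "?S = {..<card ?S}"
  proof (cases "?S = {}")
    case False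
    have "?S = {..Max ?S}"
    proof (intro subset_antisym subsetI)
      fix j assume "j \<in> {..Max ?S}"
      then show "j \<in> ?S" using down[OF Max_in[OF fin False]] by blast
    qed (use Max_ge[OF fin] in blast)
    then obtain m where "?S = {..m}" by blast
    then show ?thesis by (simp only: card_atMost lessThan_Suc_atMost)
  next
    case True
    then show ?thesis by (simp only: card.empty lessThan_0)
  qed
  then have "j \<in> ?S \<longleftrightarrow> j < card ?S" by blast
  then show ?thesis by (simp add: conjugate_partition_def Suc_le_eq)
qed

lemma conjugate_partition_eqI:
  assumes "partition_seq l" "\<And>j. j < c \<longleftrightarrow> i < l j"
  shows "conjugate_partition l i = c"
proof -
  have "j < conjugate_partition l i \<longleftrightarrow> j < c" for j
    by (simp only: assms(2) conjugate_partition_less_iff[OF assms(1)])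
  from this[of c] this[of "conjugate_partition l i"] show ?thesis by simp
qed

lemma partition_seq_conjugate:
  assumes "partition_seq l"
  shows "partition_seq (conjugate_partition l)"
proof -
  have "conjugate_partition l j \<le> conjugate_partition l i" if "i \<le> j" for i j
  proof (rule ccontr)
    let ?c = "conjugate_partition l i"
    assume "\<not> conjugate_partition l j \<le> ?c"
    then have "j < l ?c" using conjugate_partition_less_iff[OF assms, of ?c j] by simp
    with that have "i < l ?c" by simp
    then show False using conjugate_partition_less_iff[OF assms, of ?c i] by simp
  qed
  then have "antimono (conjugate_partition l)" by (rule antimonoI)
  moreover have "{i. conjugate_partition l i \<noteq> 0} \<subseteq> {..<l 0}"
    using conjugate_partition_less_iff[OF assms, of 0] by auto
  ultimately show ?thesis
    unfolding partition_seq_def using finite_subset by blast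
qed

lemma conjugate_conjugate:
  assumes "partition_seq l"
  shows "conjugate_partition (conjugate_partition l) = l"
  by (rule ext, rule conjugate_partition_eqI[OF partition_seq_conjugate[OF assms]])
    (simp add: conjugate_partition_less_iff[OF assms])

section \<open>Partitions as multisets of columns\<close>

lemma size_filter_parts:
  assumes "partition_seq l"
  shows "size {#x \<in># parts l. i < x#} = conjugate_partition l i"
proof -
  have "{x \<in> {j. l j \<noteq> 0}. i < l x} = {j. i + 1 \<le> l j}" by auto
  moreover have "finite {j. l j \<noteq> 0}" using assms by (simp add: partition_seq_def)
  ultimately show ?thesis
    by (simp add: parts_def filter_mset_image_mset filter_mset_mset_set conjugate_partition_def)
qed

lemma zero_notin_parts: "0 \<notin># parts l"
  by (cases "finite {j. l j \<noteq> 0}") (auto simp: parts_def)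

text \<open>A multiplicity is the difference of two consecutive counts; the entry \<open>0\<close>
  is invisible to them and is excluded by hypothesis.\<close>

lemma multiset_eq_if_size_filter_greater_eq:
  fixes A B :: "nat multiset"
  assumes "0 \<notin># A" "0 \<notin># B"
    and eq: "\<And>i. size {#x \<in># A. i < x#} = size {#x \<in># B. i < x#}"
  shows "A = B"
proof (rule multiset_eqI)
  have split: "size {#x \<in># M. i < x#} = count M (Suc i) + size {#x \<in># M. Suc i < x#}"
    for M :: "nat multiset" and i
    by (induction M) auto
  fix x
  show "count A x = count B x"
  proof (cases x)
    case 0
    with assms(1,2) show ?thesis by (metis not_in_iff)
  next
    case (Suc i)
    then show ?thesis using split[of i A] split[of i B] eq[of i] eq[of "Suc i"] by simp
  qed
qed

lemma size_filter_sum_mset: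
  "size {#x \<in># \<Sum>j\<in>A. M j. P x#} = (\<Sum>j\<in>A. size {#x \<in># M j. P x#})"
  by (induction A rule: infinite_finite_induct) auto

text \<open>Translates the condition on columns in \<open>S_C\<close> into one on row lengths, which
  the degrees of the \<open>g i\<close> measure.\<close>

lemma sum_parts_eq_iff:
  fixes k :: nat
  assumes l: "partition_seq l" and D: "\<And>j. j < k \<Longrightarrow> partition_seq (D j)"
  shows "(\<Sum>j<k. parts (D j)) = parts l \<longleftrightarrow>
    (\<forall>i. (\<Sum>j<k. conjugate_partition (D j) i) = conjugate_partition l i)"
proof -
  have size: "size {#x \<in># \<Sum>j<k. parts (D j). i < x#} = (\<Sum>j<k. conjugate_partition (D j) i)" for i
    using D by (simp add: size_filter_sum_mset size_filter_parts)
  have "0 \<notin># (\<Sum>j<k. parts (D j))"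
    by (induction k) (auto simp: zero_notin_parts)
  then have "(\<Sum>j<k. parts (D j)) = parts l \<longleftrightarrow>
      (\<forall>i. size {#x \<in># \<Sum>j<k. parts (D j). i < x#} = size {#x \<in># parts l. i < x#})"
    using multiset_eq_if_size_filter_greater_eq[OF _ zero_notin_parts] by metis
  then show ?thesis
    by (simp only: size size_filter_parts[OF l])
qed

section \<open>Young ideals as initial ideals\<close>

lemma z_minus_power_times_xi_power: "z_minus a ^ i * xi ^ m = monom ([:- a, 1:] ^ i) m"
proof -
  have "z_minus a ^ i = [:[:- a, 1:] ^ i:]"
    unfolding z_minus_def by (induction i) (simp_all add: one_pCons)
  then show ?thesis by (simp add: xi_power smult_monom)
qed

text \<open>\<open>conjugate_partition D i\<close> is the length of row \<open>i\<close>, the least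
  power of \<open>z - a\<close> that the ideal allows as coefficient of
  \<open>\<xi>\<^sup>i\<close>.\<close>

lemma young_ideal_eq:
  assumes D: "partition_seq D"
  shows "young_ideal D a = initial_ideal (\<lambda>i. [:- a, 1:] ^ conjugate_partition D i)"
proof
  let ?L = "[:- a, 1:]"
  have "antimono (conjugate_partition D)"
    using partition_seq_conjugate[OF D] by (simp add: partition_seq_def)
  then have "conjugate_partition D (Suc i) \<le> conjugate_partition D i" for i
    by (rule antimonoD) simp
  then have sub: "ideal.subspace (initial_ideal (\<lambda>i. ?L ^ conjugate_partition D i))"
    by (intro subspace_initial_ideal le_imp_power_dvd)
  \<comment> \<open>Row \<open>D m\<close> has no box in column \<open>m\<close>, so the generator
    of column \<open>m\<close> meets the divisibility condition at its own order.\<close>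
  have "conjugate_partition D (D m) \<le> m" for m
    using conjugate_partition_less_iff[OF D, of m "D m"] by simp
  then have "monom (?L ^ m) (D m) \<in> initial_ideal (\<lambda>i. ?L ^ conjugate_partition D i)" for m
    by (auto simp: initial_ideal_def intro: le_imp_power_dvd)
  then show "young_ideal D a \<subseteq> initial_ideal (\<lambda>i. ?L ^ conjugate_partition D i)"
    unfolding young_ideal_def by (intro ideal.span_minimal sub) (auto simp: z_minus_power_times_xi_power)
  show "initial_ideal (\<lambda>i. ?L ^ conjugate_partition D i) \<subseteq> young_ideal D a"
  proof
    fix p assume p: "p \<in> initial_ideal (\<lambda>i. ?L ^ conjugate_partition D i)"
    have "monom (coeff p i) i \<in> young_ideal D a" for i
    proof -
      let ?e = "conjugate_partition D i"
      \<comment> \<open>The generator of column \<open>?e\<close> has order at most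
        \<open>i\<close>, so a multiple of it reaches the term of order \<open>i\<close>.\<close>
      have De: "D ?e \<le> i" using conjugate_partition_less_iff[OF D, of ?e i] by simp
      have "?L ^ ?e dvd coeff p i" using p by (simp add: initial_ideal_def)
      then obtain u where "coeff p i = ?L ^ ?e * u" by (rule dvdE)
      then have "monom (?L ^ ?e) (D ?e) * monom u (i - D ?e) = monom (coeff p i) i"
        by (simp only: mult_monom le_add_diff_inverse[OF De])
      then have "monom (coeff p i) i = monom u (i - D ?e) * (z_minus a ^ ?e * xi ^ D ?e)"
        by (simp only: z_minus_power_times_xi_power mult.commute[of "monom u (i - D ?e)"])
      moreover have "monom u (i - D ?e) * (z_minus a ^ ?e * xi ^ D ?e) \<in> young_ideal D a"
        unfolding young_ideal_def by (rule ideal.span_scale[OF ideal.span_base]) (rule rangeI)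
      ultimately show ?thesis by (simp only:)
    qed
    then have "(\<Sum>i\<le>degree p. monom (coeff p i) i) \<in> young_ideal D a"
      unfolding young_ideal_def by (intro ideal.span_sum)
    then show "p \<in> young_ideal D a" by (simp add: poly_as_sum_of_monoms)
  qed
qed

text \<open>Powers of distinct linear factors are coprime, so the conditions at the points
  \<open>a j\<close> combine into a product. For \<open>k = 0\<close> both sides are the whole
  ring.\<close>

lemma Inter_young_ideal:
  fixes k :: nat
  assumes "inj_on a {..<k}" "\<And>j. j < k \<Longrightarrow> partition_seq (D j)"
  shows "(\<Inter>j<k. young_ideal (D j) (a j))
    = initial_ideal (\<lambda>i. \<Prod>j<k. [:- a j, 1:] ^ conjugate_partition (D j) i)"
  unfolding initial_ideal_def prod_linear_powers_dvd_iff[OF finite_lessThan assms(1)]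
  using assms(2) by (auto simp: young_ideal_eq initial_ideal_def)

text \<open>Testing both ideals on \<open>monom (g i) i\<close> and \<open>monom (g' i) i\<close>
  gives mutual divisibility.\<close>

lemma initial_ideal_eqD:
  assumes "initial_ideal g = initial_ideal g'" "g i \<noteq> 0" "g' i \<noteq> 0"
  shows "degree (g i) = degree (g' i)"
proof -
  have "monom (g i) i \<in> initial_ideal g" "monom (g' i) i \<in> initial_ideal g'"
    by (auto simp: initial_ideal_def)
  then have "monom (g i) i \<in> initial_ideal g'" "monom (g' i) i \<in> initial_ideal g"
    by (simp_all add: assms(1))
  then have "g' i dvd g i" "g i dvd g' i"
    unfolding initial_ideal_def by (auto dest: spec[of _ i])
  then show ?thesis
    using assms by (intro antisym dvd_imp_degree_le)
qed

section \<open>Initial ideals as torus-fixed ideals\<close>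

context leading_generators
begin

text \<open>Every \<open>g i\<close> divides \<open>g 0\<close>, so the roots of \<open>g 0\<close>
  supply all points. The multiplicities of \<open>a j\<close> in the \<open>g i\<close> are the row
  lengths of a diagram; conjugation gives its columns.\<close>

lemma initial_ideal_young:
  obtains k a D where "inj_on a {..<k}" "\<And>j. j < k \<Longrightarrow> partition_seq (D j)"
    "initial_ideal g = (\<Inter>j<k::nat. young_ideal (D j) (a j))"
proof -
  have fin: "finite {z. poly (g 0) z = 0}" by (rule poly_roots_finite[OF nonzero])
  obtain a :: "nat \<Rightarrow> complex"
    where a: "bij_betw a {..<card {z. poly (g 0) z = 0}} {z. poly (g 0) z = 0}"
    using ex_bij_betw_nat_finite[OF fin] by (auto simp: atLeast0LessThan)
  let ?k = "card {z. poly (g 0) z = 0}"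
  define E where "E j i = order (a j) (g i)" for j i
  have anti: "g j dvd g i" if "i \<le> j" for i j
    using that by (induction rule: dec_induct) (auto intro: dvd_trans g_Suc_dvd)
  have E: "partition_seq (E j)" for j
  proof -
    have "E j i' \<le> E j i" if "i \<le> i'" for i i'
      unfolding E_def by (intro dvd_imp_order_le nonzero anti that)
    then have "antimono (E j)" by (rule antimonoI)
    moreover have "{i. E j i \<noteq> 0} \<subseteq> {..<N}"
    proof
      fix i assume "i \<in> {i. E j i \<noteq> 0}"
      then have "degree (g i) \<noteq> 0"
        using order_degree[OF nonzero, of "a j" i] by (simp add: E_def)
      then show "i \<in> {..<N}" using degree_g_0[of i] by (simp, linarith)
    qed
    ultimately show ?thesis by (auto simp: partition_seq_def intro: finite_subset)
  qed
  define D where "D j = conjugate_partition (E j)" for j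
  have D: "partition_seq (D j)" for j using E by (simp add: D_def partition_seq_conjugate)
  have inj: "inj_on a {..<?k}" using a by (simp add: bij_betw_def)
  have "{z. poly (g i) z = 0} \<subseteq> a ` {..<?k}" for i
  proof -
    have "g i dvd g 0" by (rule anti) simp
    then obtain u where "g 0 = g i * u" by (rule dvdE)
    then show ?thesis unfolding bij_betw_imp_surj_on[OF a] by auto
  qed
  then have "(\<Prod>j<?k. [:- a j, 1:] ^ E j i) dvd h \<longleftrightarrow> g i dvd h" for i h
    unfolding E_def by (intro prod_linear_powers_dvd_order nonzero inj) auto
  then have "initial_ideal g = (\<Inter>j<?k. young_ideal (D j) (a j))"
    using inj D by (subst Inter_young_ideal) (auto simp: initial_ideal_def D_def conjugate_conjugate[OF E])
  with that[of a ?k D] inj D show ?thesis by blast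
qed

lemma degree_if_initial_ideal_young:
  assumes "inj_on a {..<k}" "\<And>j. j < k \<Longrightarrow> partition_seq (D j)"
    "initial_ideal g = (\<Inter>j<k::nat. young_ideal (D j) (a j))"
  shows "degree (g i) = (\<Sum>j<k. conjugate_partition (D j) i)"
proof -
  have "initial_ideal g = initial_ideal (\<lambda>i. \<Prod>j<k. [:- a j, 1:] ^ conjugate_partition (D j) i)"
    unfolding assms(3) by (rule Inter_young_ideal[OF assms(1,2)])
  from initial_ideal_eqD[OF this, of i] show ?thesis
    using nonzero by (simp add: degree_prod_linear_powers)
qed

lemma initial_ideal_in_LstarC:
  assumes "I \<in> hilb n"
  shows "initial_ideal g \<in> LstarC n"
proof -
  interpret J: leading_generators "initial_ideal g" g N by (rule leading_initial_ideal)
  \<comment> \<open>\<open>xi ^ N\<close> vanishes only on the line \<xi> = 0 and so confines the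
    support.\<close>
  have mem: "monom 1 N \<in> initial_ideal g" by (intro J.high) auto
  have "b = 0" if "\<forall>p\<in>initial_ideal g. eval2 p a b = 0" for a b
    using bspec[OF that mem] by (simp add: eval2_def poly_monom poly_power)
  then show ?thesis using limitin_act(1)[OF assms] by (auto simp: LstarC_def)
qed

text \<open>\<open>S_C\<close> asks for some decomposition into Young ideals, but all decompositions
  have the same row sums \<open>degree (g i)\<close>; hence the one from
  \<open>initial_ideal_young\<close> decides.\<close>

lemma initial_ideal_in_S_C_iff:
  assumes I: "I \<in> hilb n" and l: "partition_seq l"
  shows "initial_ideal g \<in> S_C n l \<longleftrightarrow> lambda' I = conjugate_partition l"
proof
  assume "initial_ideal g \<in> S_C n l"
  then obtain k a D where *: "inj_on a {..<k}" "\<And>j. j < k \<Longrightarrow> partition_seq (D j)"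
      "initial_ideal g = (\<Inter>j<k::nat. young_ideal (D j) (a j))"
    and "(\<Sum>j<k. parts (D j)) = parts l"
    unfolding S_C_def by blast
  then show "lambda' I = conjugate_partition l"
    using sum_parts_eq_iff[OF l *(2)] degree_if_initial_ideal_young[OF *] by (auto simp: lambda'_eq)
next
  assume lam: "lambda' I = conjugate_partition l"
  obtain k a D where *: "inj_on a {..<k}" "\<And>j. j < k \<Longrightarrow> partition_seq (D j)"
      "initial_ideal g = (\<Inter>j<k::nat. young_ideal (D j) (a j))"
    using initial_ideal_young by metis
  have "(\<Sum>j<k. parts (D j)) = parts l"
    using lam sum_parts_eq_iff[OF l *(2)] degree_if_initial_ideal_young[OF *]
    by (simp add: lambda'_eq[symmetric])
  then show "initial_ideal g \<in> S_C n l"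
    unfolding S_C_def using initial_ideal_in_LstarC[OF I] act_initial_ideal[of _ g] * by blast
qed

end

text \<open>For every \<open>I\<close> in \<open>LstarC n\<close> the limit exists and is the
  initial ideal, so membership in \<open>W_minus\<close> is a condition on that ideal alone.\<close>

lemma W_minus_eq_V:
  assumes "partition_seq l"
  shows "W_minus n l = V n (conjugate_partition l)"
proof -
  have "(\<exists>J \<in> S_C n l. limitin (classical n) (\<lambda>t. act t I) J at_infinity)
      \<longleftrightarrow> lambda' I = conjugate_partition l" if I: "I \<in> LstarC n" for I
  proof -
    obtain g N where "leading_generators I g N" by (rule LstarC_leading_generators[OF I])
    then interpret leading_generators I g N .
    have "I \<in> hilb n" using I by (simp add: LstarC_def)
    moreover from limitin_act(2)[OF this]
    \<comment> \<open>Uniqueness of the limit uses that \<open>at_infinity\<close> is a nontrivial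
      filter on the complex numbers.\<close>
    have "limitin (classical n) (\<lambda>t. act t I) J at_infinity \<longleftrightarrow> J = initial_ideal g" for J
      using limitin_classical_unique trivial_limit_at_infinity by metis
    ultimately show ?thesis
      using initial_ideal_in_S_C_iff[OF _ assms] by auto
  qed
  then show ?thesis by (auto simp: W_minus_def V_def)
qed

theorem proposition3p13:
  fixes n :: nat and l :: "nat \<Rightarrow> nat"
  assumes "partition_of n l"
  shows "L_C n l = zariski n closure_of V n (conjugate_partition l)"
  using assms by (simp add: L_C_def partition_of_def W_minus_eq_V)

end
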